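(* Let $s\in\overline{\mathbf R_\flat}$ be such that $s<\frac12$ and let $T$ be a linear and continuous map from $\mathcal A_s(\mathbf C^d)$ to $\mathcal A_s'(\mathbf C^d)$. Then there is a unique $a\in\widetilde{\mathcal A}_s'(\mathbf C^d\times\mathbf C^d)$ such that $T=\operatorname{Op}_{\mathfrak V}(a)$. The same holds true if the condition $s\in\overline{\mathbf R_\flat}$, $s<\frac12$, and the spaces $\mathcal A_s$, $\mathcal A_s'$ and $\widetilde{\mathcal A}_s'$ are replaced by $s\in\mathbf R_\flat$, $s\le\frac12$, and $\mathcal A_{0,s}$, $\mathcal A_{0,s}'$ and $\widetilde{\mathcal A}_{0,s}'$, respectively, at each occurrence.
   Context: Index sets: $\mathbf N=\{0,1,2,\dots\}$; $\mathbf R_\flat=\mathbf R_+\cup\{\flat_\sigma : \sigma>0\}$ with formal symbols $\flat_\sigma$, and $\overline{\mathbf R_\flat}=\mathbf R_\flat\cup\{0\}$. The order extends the usual order on $[0,\infty)$ by $x_1<\flat_{\sigma_1}<\flat_{\sigma_2}<x_2$ whenever $0\le x_1<\frac12\le x_2$ and $0<\sigma_1<\sigma_2$. Sequence spaces: for $s\in\mathbf R_\flat$, $r>0$, $\alpha\in\mathbf N^n$ let $\vartheta_{r,s}(\alpha)=e^{r|\alpha|^{1/(2s)}}$ if $s\in\mathbf R_+$ and $\vartheta_{r,s}(\alpha)=r^{|\alpha|}(\alpha!)^{1/(2\sigma)}$ if $s=\flat_\sigma$. Let $\ell^p_{[\vartheta]}(\mathbf N^n)$ be the Banach space of complex sequences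 $c$ with $\|c\,\vartheta\|_{\ell^p}<\infty$; fix any $p\in[1,\infty]$ (the spaces below do not depend on it). For $s\in\mathbf R_\flat$: $\ell_{0,s}=\bigcap_{r>0}\ell^p_{[\vartheta_{r,s}]}$ and $\ell_s'=\bigcap_{r>0}\ell^p_{[1/\vartheta_{r,s}]}$ with projective limit topologies; $\ell_s=\bigcup_{r>0}\ell^p_{[\vartheta_{r,s}]}$ and $\ell_{0,s}'=\bigcup_{r>0}\ell^p_{[1/\vartheta_{r,s}]}$ with inductive limit topologies. $\ell_0'(\mathbf N^n)$ is the space of all complex sequences with the topology of the seminorms $c\mapsto\|\{c_\alpha\}_{|\alpha|\le N}\|_{\ell^p}$; $\ell_0(\mathbf N^n)$ is the space of finitely supported sequences with the inductive limit topology of the spaces $\{c : c_\alpha=0\text{ for }|\alpha|>N\}$. Power series spaces: $e_\alpha(z)=z^\alpha/\sqrt{\alpha!}$. $\mathcal A_{0,s}(\mathbf C^d)$, $\mathcal A_s(\mathbf C^d)$, $\mathcal A_s'(\mathbf C^d)$, $\mathcal A_{0,s}'(\mathbf C^d)$ consist of all formal power series $F=\sum_\alpha c(F,\alpha)e_\alpha$ with coefficients in $\ell_{0,s}(\mathbf N^d)$, $\ell_s(\mathbf N^d)$, $\ell_s'(\mathbf N^d)$, $\ell_{0,s}'(\mathbf N^d)$ respectively, with transported topologies. $\widetilde{\mathcal A}_s'(\mathbf C^d\times\mathbf C^d)$ and $\widetilde{\mathcal A}_{0,s}'(\mathbf C^d\times\mathbf C^d)$ consist of all formal series $a(z,w)=\sum_{\alpha,\beta\in\mathbf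 N^d}c_a(\alpha,\beta)e_\alpha(z)e_\beta(\overline w)$ with $c_a$ in $\ell_s'(\mathbf N^{2d})$ and $\ell_{0,s}'(\mathbf N^{2d})$ respectively. Analytic pseudo-differential operator: formally $(\operatorname{Op}_{\mathfrak V}(a)F)(z)=\int_{\mathbf C^d}a(z,w)F(w)e^{(z,w)}\,d\mu(w)$, with $(z,w)=\sum_jz_j\overline{w_j}$ and $d\mu(w)=\pi^{-d}e^{-|w|^2}d\lambda(w)$. In general $\operatorname{Op}_{\mathfrak V}(a)$ is the operator with kernel $K=e^{(z,w)}a(z,w)$ with respect to $d\mu$, where this multiplication is the (continuously extended) map on formal series with coefficients $c_K(\alpha,\beta)=\sum_{\gamma\le\alpha,\beta}c_a(\alpha-\gamma,\beta-\gamma)\left(\binom{\alpha}{\gamma}\binom{\beta}{\gamma}\right)^{1/2}$, and the operator with kernel $K$ maps $F=\sum c(F,\beta)e_\beta$ to $\sum_\alpha\big(\sum_\beta c_K(\alpha,\beta)c(F,\beta)\big)e_\alpha$ (the duality extension of $F\mapsto\int K(\cdot,w)F(w)\,d\mu(w)$). *)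

theory Defs
  imports "HOL-Analysis.Analysis" "HOL-Library.Function_Algebras"
begin

subsection \<open>The index set\<close>

text \<open>
  \<open>Num x\<close> is the real number \<open>x\<close> and \<open>Flat \<sigma>\<close> the formal symbol \<open>\<flat>\<^sub>\<sigma>\<close>. The datatype also contains
  values without meaning (negative reals, \<open>\<flat>\<^sub>\<sigma>\<close> with \<open>\<sigma> \<le> 0\<close>); \<open>Rflat\<close> and \<open>Rflat0\<close> exclude them.
\<close>

datatype rflat = Num real | Flat real

definition Rflat :: "rflat set" where
  "Rflat = {Num x |x. 0 < x} \<union> {Flat \<sigma> |\<sigma>. 0 < \<sigma>}"

definition Rflat0 :: "rflat set" where
  "Rflat0 = insert (Num 0) Rflat"

instantiation rflat :: linorder
begin

fun less_rflat :: "rflat \<Rightarrow> rflat \<Rightarrow> bool" where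
  "less_rflat (Num x) (Num y) \<longleftrightarrow> x < y"
| "less_rflat (Flat \<sigma>) (Flat \<tau>) \<longleftrightarrow> \<sigma> < \<tau>"
| "less_rflat (Num x) (Flat \<sigma>) \<longleftrightarrow> x < 1/2"
| "less_rflat (Flat \<sigma>) (Num x) \<longleftrightarrow> 1/2 \<le> x"

definition less_eq_rflat :: "rflat \<Rightarrow> rflat \<Rightarrow> bool" where
  "s \<le> t \<longleftrightarrow> s = t \<or> s < (t :: rflat)"

instance
proof
  fix s t u :: rflat
  show "s < t \<longleftrightarrow> s \<le> t \<and> \<not> t \<le> s"
    by (cases s; cases t) (auto simp: less_eq_rflat_def)
  show "s \<le> s"
    by (simp add: less_eq_rflat_def)
  show "s \<le> t \<Longrightarrow> t \<le> u \<Longrightarrow> s \<le> u"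
    by (cases s; cases t; cases u) (auto simp: less_eq_rflat_def)
  show "s \<le> t \<Longrightarrow> t \<le> s \<Longrightarrow> s = t"
    by (cases s; cases t) (auto simp: less_eq_rflat_def)
  show "s \<le> t \<or> t \<le> s"
    by (cases s; cases t) (auto simp: less_eq_rflat_def)
qed

end


subsection \<open>Multi-indices and sequences\<close>

text \<open>
  \<open>\<nat>\<^sup>n\<close> is the type \<open>'n \<Rightarrow> nat\<close> for a finite type \<open>'n\<close> with \<open>n\<close> elements; \<open>\<nat>\<^sup>2\<^sup>d\<close> is
  \<open>'d + 'd \<Rightarrow> nat\<close>. The operations and the order on multi-indices are the pointwise ones.
\<close>

type_synonym 'n mindex = "'n \<Rightarrow> nat"
type_synonym 'n mseq = "'n mindex \<Rightarrow> complex"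

definition mabs :: "'n::finite mindex \<Rightarrow> nat" where
  "mabs \<alpha> = (\<Sum>i\<in>UNIV. \<alpha> i)"

definition mfact :: "'n::finite mindex \<Rightarrow> real" where
  "mfact \<alpha> = (\<Prod>i\<in>UNIV. fact (\<alpha> i))"

definition mbinom :: "'n::finite mindex \<Rightarrow> 'n mindex \<Rightarrow> real" where
  "mbinom \<alpha> \<gamma> = (\<Prod>i\<in>UNIV. real (\<alpha> i choose \<gamma> i))"

fun weight :: "real \<Rightarrow> rflat \<Rightarrow> 'n::finite mindex \<Rightarrow> real" where
  "weight r (Num s) \<alpha> = exp (r * real (mabs \<alpha>) powr (1 / (2 * s)))"
| "weight r (Flat \<sigma>) \<alpha> = r ^ mabs \<alpha> * mfact \<alpha> powr (1 / (2 * \<sigma>))"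

definition in_lp :: "ereal \<Rightarrow> ('i \<Rightarrow> complex) \<Rightarrow> bool" where
  "in_lp p c \<longleftrightarrow>
    (if p = \<infinity> then bounded (range c)
     else (\<lambda>i. norm (c i) powr real_of_ereal p) summable_on UNIV)"

definition lp_norm :: "ereal \<Rightarrow> ('i \<Rightarrow> complex) \<Rightarrow> real" where
  "lp_norm p c =
    (if p = \<infinity> then (SUP i. norm (c i))
     else (\<Sum>\<^sub>\<infinity>i. norm (c i) powr real_of_ereal p) powr (1 / real_of_ereal p))"


subsection \<open>Locally convex topologies, projective and inductive limits\<close>

text \<open>
  All vector spaces are complex subspaces of a type \<open>'i \<Rightarrow> complex\<close>, given as the \<open>topspace\<close>
  of their topology.
\<close>

definition seminorm_on :: "('i \<Rightarrow> complex) set \<Rightarrow> (('i \<Rightarrow> complex) \<Rightarrow> real) \<Rightarrow> bool" where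
  "seminorm_on E q \<longleftrightarrow>
    (\<forall>x\<in>E. 0 \<le> q x) \<and>
    (\<forall>x\<in>E. \<forall>y\<in>E. q (x + y) \<le> q x + q y) \<and>
    (\<forall>x\<in>E. \<forall>k. q (\<lambda>i. k * x i) = norm k * q x)"

definition seminorm_topology ::
    "('i \<Rightarrow> complex) set \<Rightarrow> (('i \<Rightarrow> complex) \<Rightarrow> real) set \<Rightarrow> ('i \<Rightarrow> complex) topology" where
  "seminorm_topology E Q =
    topology_generated_by (insert E {{y \<in> E. q (y - x) < \<epsilon>} |q x \<epsilon>. q \<in> Q \<and> x \<in> E \<and> 0 < \<epsilon>})"

definition locally_convex :: "('i \<Rightarrow> complex) set \<Rightarrow> ('i \<Rightarrow> complex) topology \<Rightarrow> bool" where
  "locally_convex E X \<longleftrightarrow> (\<exists>Q. (\<forall>q\<in>Q. seminorm_on E q) \<and> X = seminorm_topology E Q)"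

text \<open>The coarsest topology on the intersection for which all inclusions are continuous.\<close>

definition projective_limit :: "('i \<Rightarrow> complex) topology set \<Rightarrow> ('i \<Rightarrow> complex) topology" where
  "projective_limit \<X> =
    topology_generated_by {U \<inter> (\<Inter>X\<in>\<X>. topspace X) |U. \<exists>X\<in>\<X>. openin X U}"

text \<open>
  The finest locally convex topology on the union for which all inclusions are continuous, as the
  supremum of all such topologies (a supremum of locally convex topologies is locally convex:
  take the union of the families of seminorms).
\<close>

definition inductive_limit :: "('i \<Rightarrow> complex) topology set \<Rightarrow> ('i \<Rightarrow> complex) topology" where
  "inductive_limit \<X> =
    topology_generated_by
      {U. \<exists>Y. locally_convex (\<Union>X\<in>\<X>. topspace X) Y \<and>
              (\<forall>X\<in>\<X>. continuous_map X Y (\<lambda>c. c)) \<and> openin Y U}"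

lemma topspace_seminorm_topology [simp]: "topspace (seminorm_topology E Q) = E"
  by (auto simp: seminorm_topology_def)

lemma topspace_projective_limit:
  "\<X> \<noteq> {} \<Longrightarrow> topspace (projective_limit \<X>) = (\<Inter>X\<in>\<X>. topspace X)"
  unfolding projective_limit_def topology_generated_by_topspace by blast

lemma topspace_inductive_limit: "topspace (inductive_limit \<X>) = (\<Union>X\<in>\<X>. topspace X)"
proof -
  define E where "E = (\<Union>X\<in>\<X>. topspace X)"
  define Y where "Y = seminorm_topology E {}"
  have lc: "locally_convex E Y"
    unfolding locally_convex_def Y_def by (intro exI[of _ "{}"]) simp
  have cont: "continuous_map X Y (\<lambda>c. c)" if "X \<in> \<X>" for X
    unfolding Y_def seminorm_topology_def
  proof (rule continuous_on_generated_topo)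
    fix U assume "U \<in> insert E {{y \<in> E. q (y - x) < \<epsilon>} |q x \<epsilon>. q \<in> {} \<and> x \<in> E \<and> 0 < \<epsilon>}"
    then have "(\<lambda>c. c) -` U \<inter> topspace X = topspace X"
      using that by (auto simp: E_def)
    then show "openin X ((\<lambda>c. c) -` U \<inter> topspace X)"
      by simp
  qed (use that in \<open>auto simp: E_def\<close>)
  have "openin Y E"
    using openin_topspace[of Y] by (simp add: Y_def)
  then have "E \<subseteq> topspace (inductive_limit \<X>)"
    using lc cont unfolding inductive_limit_def topology_generated_by_topspace E_def by blast
  moreover have "topspace (inductive_limit \<X>) \<subseteq> E"
    unfolding inductive_limit_def topology_generated_by_topspace E_def[symmetric]
    by (auto simp: locally_convex_def dest!: openin_subset)
  ultimately show ?thesis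
    by (simp add: E_def)
qed


subsection \<open>The sequence spaces\<close>

definition weighted_lp :: "ereal \<Rightarrow> ('n::finite mindex \<Rightarrow> real) \<Rightarrow> 'n mseq topology" where
  "weighted_lp p w =
    seminorm_topology {c. in_lp p (\<lambda>\<alpha>. c \<alpha> * of_real (w \<alpha>))}
      {\<lambda>c. lp_norm p (\<lambda>\<alpha>. c \<alpha> * of_real (w \<alpha>))}"

text \<open>
  \<open>ell_s p s\<close>, \<open>ell_0s p s\<close>, \<open>ell_s' p s\<close> and \<open>ell_0s' p s\<close> are \<open>\<ell>\<^sub>s\<close>, \<open>\<ell>\<^sub>0\<^sub>,\<^sub>s\<close>, \<open>\<ell>\<^sub>s'\<close> and \<open>\<ell>\<^sub>0\<^sub>,\<^sub>s'\<close>.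
  Those with subscript \<open>0,s\<close> are meant for \<open>s \<in> Rflat\<close> only.
\<close>

definition ell_s :: "ereal \<Rightarrow> rflat \<Rightarrow> 'n::finite mseq topology" where
  "ell_s p s =
    (if s = Num 0
     then inductive_limit
            (range (\<lambda>N. seminorm_topology {c. \<forall>\<alpha>. N < mabs \<alpha> \<longrightarrow> c \<alpha> = 0} {lp_norm p}))
     else inductive_limit ((\<lambda>r. weighted_lp p (weight r s)) ` {0<..}))"

definition ell_0s :: "ereal \<Rightarrow> rflat \<Rightarrow> 'n::finite mseq topology" where
  "ell_0s p s = projective_limit ((\<lambda>r. weighted_lp p (weight r s)) ` {0<..})"

definition ell_s' :: "ereal \<Rightarrow> rflat \<Rightarrow> 'n::finite mseq topology" where
  "ell_s' p s =
    (if s = Num 0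
     then seminorm_topology UNIV
            (range (\<lambda>N c. lp_norm p (\<lambda>\<alpha>. if mabs \<alpha> \<le> N then c \<alpha> else 0)))
     else projective_limit ((\<lambda>r. weighted_lp p (\<lambda>\<alpha>. 1 / weight r s \<alpha>)) ` {0<..}))"

definition ell_0s' :: "ereal \<Rightarrow> rflat \<Rightarrow> 'n::finite mseq topology" where
  "ell_0s' p s = inductive_limit ((\<lambda>r. weighted_lp p (\<lambda>\<alpha>. 1 / weight r s \<alpha>)) ` {0<..})"


subsection \<open>The spaces of formal power series\<close>

text \<open>
  A formal power series is given by the coefficients \<open>F \<alpha>\<close> of the monomials \<open>z\<^sup>\<alpha>\<close>. Since
  \<open>e\<^sub>\<alpha>(z) = z\<^sup>\<alpha> / sqrt(\<alpha>!)\<close>, its coefficient \<open>c(F,\<alpha>)\<close> with respect to \<open>e\<^sub>\<alpha>\<close> is \<open>sqrt(\<alpha>!) * F \<alpha>\<close>.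
\<close>

type_synonym 'd fseries = "'d mindex \<Rightarrow> complex"

definition coeff_e :: "'d::finite fseries \<Rightarrow> 'd mseq" where
  "coeff_e F = (\<lambda>\<alpha>. of_real (sqrt (mfact \<alpha>)) * F \<alpha>)"

definition series_e :: "'d::finite mseq \<Rightarrow> 'd fseries" where
  "series_e c = (\<lambda>\<alpha>. c \<alpha> / of_real (sqrt (mfact \<alpha>)))"

definition A_s :: "ereal \<Rightarrow> rflat \<Rightarrow> 'd::finite fseries topology" where
  "A_s p s = pullback_topology UNIV coeff_e (ell_s p s)"

definition A_0s :: "ereal \<Rightarrow> rflat \<Rightarrow> 'd::finite fseries topology" where
  "A_0s p s = pullback_topology UNIV coeff_e (ell_0s p s)"

definition A_s' :: "ereal \<Rightarrow> rflat \<Rightarrow> 'd::finite fseries topology" where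
  "A_s' p s = pullback_topology UNIV coeff_e (ell_s' p s)"

definition A_0s' :: "ereal \<Rightarrow> rflat \<Rightarrow> 'd::finite fseries topology" where
  "A_0s' p s = pullback_topology UNIV coeff_e (ell_0s' p s)"

text \<open>
  A formal series in \<open>z\<close> and the conjugate of \<open>w\<close>: \<open>a \<alpha> \<beta>\<close> is the coefficient of
  \<open>z\<^sup>\<alpha> (cnj w)\<^sup>\<beta>\<close>.
\<close>

type_synonym 'd fseries2 = "'d mindex \<Rightarrow> 'd mindex \<Rightarrow> complex"

definition coeff_e2 :: "'d::finite fseries2 \<Rightarrow> 'd mindex \<Rightarrow> 'd mindex \<Rightarrow> complex" where
  "coeff_e2 a = (\<lambda>\<alpha> \<beta>. of_real (sqrt (mfact \<alpha>) * sqrt (mfact \<beta>)) * a \<alpha> \<beta>)"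

definition series_e2 :: "('d::finite mindex \<Rightarrow> 'd mindex \<Rightarrow> complex) \<Rightarrow> 'd fseries2" where
  "series_e2 c = (\<lambda>\<alpha> \<beta>. c \<alpha> \<beta> / of_real (sqrt (mfact \<alpha>) * sqrt (mfact \<beta>)))"

definition A_tilde_s' :: "ereal \<Rightarrow> rflat \<Rightarrow> 'd::finite fseries2 set" where
  "A_tilde_s' p s = {a. (\<lambda>\<kappa>. coeff_e2 a (\<kappa> \<circ> Inl) (\<kappa> \<circ> Inr)) \<in> topspace (ell_s' p s)}"

definition A_tilde_0s' :: "ereal \<Rightarrow> rflat \<Rightarrow> 'd::finite fseries2 set" where
  "A_tilde_0s' p s = {a. (\<lambda>\<kappa>. coeff_e2 a (\<kappa> \<circ> Inl) (\<kappa> \<circ> Inr)) \<in> topspace (ell_0s' p s)}"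

lemma mfact_pos: "0 < mfact \<alpha>"
  by (auto simp: mfact_def intro: prod_pos)

lemma coeff_e_series_e [simp]: "coeff_e (series_e c) = c"
  and series_e_coeff_e [simp]: "series_e (coeff_e F) = F"
  by (auto simp: coeff_e_def series_e_def mfact_pos less_imp_neq[symmetric])

lemma coeff_e2_series_e2 [simp]: "coeff_e2 (series_e2 c) = c"
  and series_e2_coeff_e2 [simp]: "series_e2 (coeff_e2 a) = a"
  by (auto simp: coeff_e2_def series_e2_def mfact_pos less_imp_neq[symmetric])


subsection \<open>Analytic pseudo-differential operators\<close>

text \<open>Multiplication by \<open>e\<^bsup>(z,w)\<^esup>\<close> on formal series.\<close>

definition mult_exp :: "'d::finite fseries2 \<Rightarrow> 'd fseries2" where
  "mult_exp a = series_e2 (\<lambda>\<alpha> \<beta>.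
     \<Sum>\<gamma> | \<gamma> \<le> \<alpha> \<and> \<gamma> \<le> \<beta>.
       coeff_e2 a (\<alpha> - \<gamma>) (\<beta> - \<gamma>) * of_real (sqrt (mbinom \<alpha> \<gamma> * mbinom \<beta> \<gamma>)))"

text \<open>
  The operator with kernel \<open>K\<close> with respect to the Gaussian measure \<open>\<mu>\<close>. The sum over \<open>\<beta>\<close> converges
  absolutely when \<open>K\<close> is in \<open>A_tilde_s' p s\<close> and \<open>F\<close> in \<open>A_s p s\<close>, and when \<open>K\<close> is in
  \<open>A_tilde_0s' p s\<close> and \<open>F\<close> in \<open>A_0s p s\<close>.
\<close>

definition kernel_op :: "'d::finite fseries2 \<Rightarrow> 'd fseries \<Rightarrow> 'd fseries" where
  "kernel_op K F = series_e (\<lambda>\<alpha>. \<Sum>\<^sub>\<infinity>\<beta>. coeff_e2 K \<alpha> \<beta> * coeff_e F \<beta>)"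

definition Op_V :: "'d::finite fseries2 \<Rightarrow> 'd fseries \<Rightarrow> 'd fseries" where
  "Op_V a = kernel_op (mult_exp a)"

definition clinear_on :: "'d fseries set \<Rightarrow> ('d fseries \<Rightarrow> 'd fseries) \<Rightarrow> bool" where
  "clinear_on E T \<longleftrightarrow>
    (\<forall>F\<in>E. \<forall>G\<in>E. T (F + G) = T F + T G) \<and>
    (\<forall>k. \<forall>F\<in>E. T (\<lambda>\<alpha>. k * F \<alpha>) = (\<lambda>\<alpha>. k * T F \<alpha>))"

end

theory Submission
  imports Defs
begin

text \<open>
  Conjugating \<open>T\<close> with the passage to coefficients gives a linear map \<open>S\<close> of sequence spaces, whose
  kernel is \<open>k(\<alpha>,\<beta>) = (S \<delta>\<^sub>\<beta>)(\<alpha>)\<close>. Multiplication by \<open>e\<^bsup>(z,w)\<^esup>\<close> is a bijection on formal series, with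
  inverse the multiplication by \<open>e\<^bsup>-(z,w)\<^esup>\<close>, so the symbol exists uniquely as a formal series as soon as
  \<open>S c = \<Sum>\<^sub>\<beta> k(\<cdot>,\<beta>) c\<^sub>\<beta>\<close>, and only the growth of \<open>k\<close> matters. The inverse costs at most a factor \<open>4\<^bsup>|\<alpha>+\<beta>|\<^esup>\<close>,
  which the weights absorb: for \<open>s < 1/2\<close> in passing from some smaller \<open>r\<close> to a given one, for
  \<open>s \<le> 1/2\<close> in passing from a given \<open>r\<close> to some larger one; the same fact makes all exponents \<open>p\<close> equivalent and reduces everything to weighted \<open>\<ell>\<^sup>1\<close> norms.

  If \<open>T\<close> maps \<open>A\<^sub>s\<close> to \<open>A\<^sub>s'\<close>, continuity between the steps of the limits gives
  \<open>|k(\<alpha>,\<beta>)| \<le> C w\<^sub>R(\<alpha>) w\<^sub>r(\<beta>)\<close> for all \<open>r, R\<close>. If \<open>T\<close> maps \<open>A\<^sub>0\<^sub>,\<^sub>s\<close> to \<open>A\<^sub>0\<^sub>,\<^sub>s'\<close>, the bound is needed for one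
  pair \<open>r, R\<close> only; it follows by a gliding hump argument, testing with the continuous seminorms
  \<open>c \<mapsto> sup |c\<^sub>\<alpha>| u\<^sub>\<alpha>\<close> on the inductive limit. For \<open>s = 0\<close> there is nothing to estimate.
\<close>

subsection \<open>The spaces \<open>\<ell>\<^sup>p\<close>\<close>

text \<open>The norm bound in terms of finite partial sums of powers, so that inequalities can be
  proved for finite sums, without roots or convergence. It is applied with positive
  \<open>a\<close>.\<close>

definition lp_le :: "ereal \<Rightarrow> ('i \<Rightarrow> complex) \<Rightarrow> real \<Rightarrow> bool" where
  "lp_le p c a \<longleftrightarrow>
    (if p = \<infinity> then \<forall>i. norm (c i) \<le> a
     else \<forall>F. finite F \<longrightarrow> (\<Sum>i\<in>F. norm (c i) powr real_of_ereal p) \<le> a powr real_of_ereal p)"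

lemma one_le_real_of_ereal:
  assumes "1 \<le> p" "p \<noteq> (\<infinity>::ereal)"
  shows "1 \<le> real_of_ereal p"
  using assms by (cases p) auto

lemma lp_le_iff:
  assumes p: "1 \<le> p" and a: "0 < a"
  shows "lp_le p c a \<longleftrightarrow> in_lp p c \<and> lp_norm p c \<le> a"
proof (cases "p = \<infinity>")
  case True
  have "(\<forall>i. norm (c i) \<le> a) \<longleftrightarrow> bounded (range c) \<and> (SUP i. norm (c i)) \<le> a"
  proof safe
    assume *: "\<forall>i. norm (c i) \<le> a"
    then show "bounded (range c)"
      by (auto simp: bounded_iff)
    from * show "(SUP i. norm (c i)) \<le> a"
      by (intro cSUP_least) auto
  next
    fix i assume "bounded (range c)" and le: "(SUP i. norm (c i)) \<le> a"
    then have "bdd_above (range (\<lambda>i. norm (c i)))"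
      by (force simp: bounded_iff bdd_above_def)
    then have "norm (c i) \<le> (SUP i. norm (c i))"
      by (rule cSUP_upper2) auto
    with le show "norm (c i) \<le> a" by simp
  qed
  with True show ?thesis
    by (simp add: lp_le_def in_lp_def lp_norm_def)
next
  case False
  define P where "P = real_of_ereal p"
  have P: "1 \<le> P" using one_le_real_of_ereal[OF p False] by (simp add: P_def)
  let ?f = "\<lambda>i. norm (c i) powr P"
  have nn: "0 \<le> infsum ?f UNIV"
    by (intro infsum_nonneg) auto
  have "(\<forall>F. finite F \<longrightarrow> sum ?f F \<le> a powr P) \<longleftrightarrow>
      ?f summable_on UNIV \<and> (infsum ?f UNIV) powr (1 / P) \<le> a"
  proof (intro iffI conjI allI impI; (elim conjE)?)
    assume *: "\<forall>F. finite F \<longrightarrow> sum ?f F \<le> a powr P"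
    then show s: "?f summable_on UNIV"
      by (intro nonneg_bdd_above_summable_on) (auto simp: bdd_above_def)
    with * have "infsum ?f UNIV \<le> a powr P"
      by (intro infsum_le_finite_sums) auto
    then have "(infsum ?f UNIV) powr (1 / P) \<le> (a powr P) powr (1 / P)"
      using nn P by (intro powr_mono2) auto
    then show "(infsum ?f UNIV) powr (1 / P) \<le> a"
      using P a by (simp add: powr_powr)
  next
    fix F :: "'a set"
    assume F: "finite F" and s: "?f summable_on UNIV" and le: "(infsum ?f UNIV) powr (1 / P) \<le> a"
    have "sum ?f F \<le> infsum ?f UNIV"
      using F s by (intro finite_sum_le_infsum) auto
    also have "\<dots> = ((infsum ?f UNIV) powr (1 / P)) powr P"
      using nn P by (simp add: powr_powr)
    also have "\<dots> \<le> a powr P"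
      using le P by (intro powr_mono2) auto
    finally show "sum ?f F \<le> a powr P" .
  qed
  with False show ?thesis
    by (simp add: lp_le_def in_lp_def lp_norm_def P_def)
qed

lemma lp_norm_nonneg: "0 \<le> lp_norm p c" if "in_lp p c"
proof (cases "p = \<infinity>")
  case True
  with that have "bdd_above (range (\<lambda>i. norm (c i)))"
    by (force simp: bounded_iff bdd_above_def in_lp_def)
  then have "norm (c undefined) \<le> (SUP i. norm (c i))"
    by (rule cSUP_upper2) auto
  then have "0 \<le> (SUP i. norm (c i))" 
    using norm_ge_zero order_trans by blast
  then show ?thesis by (simp add: lp_norm_def True)
qed (simp add: lp_norm_def)

text \<open>The strict inequality makes \<open>a\<close> positive even when the norm is 0, as
  \<open>lp_le_iff\<close> requires. Inequalities between norms are recovered by letting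
  \<open>a\<close> decrease to the norm.\<close>

lemma in_lp_imp_lp_le:
  assumes "1 \<le> p" "in_lp p c" "lp_norm p c < a"
  shows "0 < a" "lp_le p c a"
proof -
  show "0 < a" using lp_norm_nonneg[OF assms(2)] assms(3) by simp
  then show "lp_le p c a" using assms by (simp add: lp_le_iff)
qed

lemma lp_le_pointwise:
  assumes "1 \<le> p" "0 < a" "lp_le p c a"
  shows "norm (c i) \<le> a"
proof (cases "p = \<infinity>")
  case False
  define P where "P = real_of_ereal p"
  have P: "1 \<le> P" using one_le_real_of_ereal[OF assms(1) False] by (simp add: P_def)
  have "(\<Sum>i\<in>{i}. norm (c i) powr P) \<le> a powr P"
    using assms(3) False unfolding lp_le_def P_def by (metis finite.emptyI finite_insert)
  then have "norm (c i) powr P \<le> a powr P"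
    by simp
  then show ?thesis
    using P assms(2) by (meson norm_ge_zero not_le powr_less_mono2 less_imp_le less_le_trans zero_less_one)
qed (use assms in \<open>simp add: lp_le_def\<close>)

lemma norm_le_lp_norm:
  assumes "1 \<le> p" "in_lp p c"
  shows "norm (c i) \<le> lp_norm p c"
proof (rule dense_ge)
  fix a assume "lp_norm p c < a"
  then show "norm (c i) \<le> a"
    using in_lp_imp_lp_le[OF assms, of a] lp_le_pointwise[OF assms(1), of a c i] by simp
qed

text \<open>Summed over \<open>i\<close> with \<open>u = |x\<^sub>i|\<close>, \<open>v = |y\<^sub>i|\<close> and \<open>a\<close>, \<open>b\<close> bounds for the norms of \<open>x\<close> and \<open>y\<close>,
  this is Minkowski's inequality.\<close>

lemma powr_add_le_convex:
  fixes u v a b P :: real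
  assumes P: "1 \<le> P" and "0 \<le> u" "0 \<le> v" and a: "0 < a" and b: "0 < b"
  shows "(u + v) powr P \<le>
    (a + b) powr P * (a / (a + b) * (u powr P / a powr P) + b / (a + b) * (v powr P / b powr P))"
proof -
  define t where "t = b / (a + b)"
  have t: "0 < t" "t < 1" "1 - t = a / (a + b)"
    using a b by (auto simp: t_def field_simps)
  \<comment> \<open>Convexity is applied to positive arguments. If one argument vanishes, the claim
    reduces to t'^P \<le> t' for 0 < t' < 1.\<close>
  have conv: "((1 - t) * x + t * y) powr P \<le> (1 - t) * x powr P + t * y powr P"
    if xy: "0 \<le> x" "0 \<le> y" for x y
  proof -
    have small: "t' * z powr P \<ge> (t' * z) powr P" if "0 < t'" "t' < 1" "0 \<le> z" for t' z
    proof -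
      have "t' powr P \<le> t' powr 1"
        using that P by (intro powr_mono') auto
      then show ?thesis
        using that by (simp add: powr_mult mult_right_mono)
    qed
    consider "x = 0" | "y = 0" | "0 < x \<and> 0 < y" using xy by argo
    then show ?thesis
    proof cases
      case 1 then show ?thesis using small[of t y] t xy by simp
    next
      case 2 then show ?thesis using small[of "1 - t" x] t xy by simp
    next
      case 3
      then show ?thesis
        using convex_onD[OF powr_convex[OF P], of t x y] t by simp
    qed
  qed
  \<comment> \<open>The sum is a + b times a convex combination of u/a and v/b, whose weights are
    proportional to the two norm bounds.\<close>
  have "u + v = (a + b) * (a / (a + b) * (u / a) + b / (a + b) * (v / b))"
    using a b by (simp add: distrib_left)
  then have "(u + v) powr P = ((a + b) * (a / (a + b) * (u / a) + b / (a + b) * (v / b))) powr P"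
    by (rule arg_cong)
  also have "\<dots> = (a + b) powr P * (a / (a + b) * (u / a) + b / (a + b) * (v / b)) powr P"
    by (rule powr_mult)
  also have "\<dots> \<le> (a + b) powr P * (a / (a + b) * (u / a) powr P + b / (a + b) * (v / b) powr P)"
    using assms conv[of "u / a" "v / b", unfolded t(3), unfolded t_def]
    by (intro mult_left_mono) auto
  also have "\<dots> = (a + b) powr P * (a / (a + b) * (u powr P / a powr P) + b / (a + b) * (v powr P / b powr P))"
    by (simp only: powr_divide)
  finally show ?thesis .
qed

lemma lp_le_add:
  assumes "1 \<le> p" and a: "0 < a" and b: "0 < b" and x: "lp_le p x a" and y: "lp_le p y b"
  shows "lp_le p (\<lambda>i. x i + y i) (a + b)"
proof (cases "p = \<infinity>")
  case True
  with x y show ?thesis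
    by (auto simp: lp_le_def intro: norm_triangle_mono)
next
  case False
  define P where "P = real_of_ereal p"
  have P: "1 \<le> P" using one_le_real_of_ereal[OF assms(1) False] by (simp add: P_def)
  have "(\<Sum>i\<in>F. norm (x i + y i) powr P) \<le> (a + b) powr P" if "finite F" for F
  proof -
    have X: "(\<Sum>i\<in>F. norm (x i) powr P) \<le> a powr P" and Y: "(\<Sum>i\<in>F. norm (y i) powr P) \<le> b powr P"
      using x y that False by (auto simp: lp_le_def P_def)
    have "(\<Sum>i\<in>F. norm (x i + y i) powr P) \<le> (\<Sum>i\<in>F. (norm (x i) + norm (y i)) powr P)"
      using P by (intro sum_mono powr_mono2) (auto intro: norm_triangle_ineq)
    also have "\<dots> \<le> (\<Sum>i\<in>F. (a + b) powr P * (a / (a + b) * (norm (x i) powr P / a powr P)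
        + b / (a + b) * (norm (y i) powr P / b powr P)))"
      using P a b by (intro sum_mono powr_add_le_convex) auto
    also have "\<dots> = (a + b) powr P * (a / (a + b) * ((\<Sum>i\<in>F. norm (x i) powr P) / a powr P)
        + b / (a + b) * ((\<Sum>i\<in>F. norm (y i) powr P) / b powr P))"
      by (simp only: sum_distrib_left[symmetric] sum.distrib sum_divide_distrib[symmetric])
    also have "\<dots> \<le> (a + b) powr P * (a / (a + b) * 1 + b / (a + b) * 1)"
      using a b X Y by (intro mult_left_mono add_mono) (auto simp: divide_le_eq)
    also have "\<dots> = (a + b) powr P"
      using a b by (simp add: add_divide_distrib[symmetric])
    finally show ?thesis .
  qed
  with False show ?thesis by (simp add: lp_le_def P_def)
qed

lemma lp_le_scale:
  assumes "1 \<le> p" "0 < a" "lp_le p c a" "k \<noteq> 0"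
  shows "lp_le p (\<lambda>i. k * c i) (norm k * a)"
proof (cases "p = \<infinity>")
  case True
  with assms show ?thesis by (simp add: lp_le_def norm_mult)
next
  case False
  with assms show ?thesis
    by (auto simp: lp_le_def norm_mult powr_mult sum_distrib_left[symmetric])
qed

lemma in_lp_iff:
  assumes "1 \<le> p"
  shows "in_lp p c \<longleftrightarrow> (\<exists>a>0. lp_le p c a)"
proof
  assume "in_lp p c"
  then show "\<exists>a>0. lp_le p c a"
    using in_lp_imp_lp_le[OF assms, of c "lp_norm p c + 1"] by auto
qed (auto simp: lp_le_iff[OF assms])

lemma in_lp_add:
  assumes "1 \<le> p" "in_lp p x" "in_lp p y"
  shows "in_lp p (\<lambda>i. x i + y i)"
proof -
  obtain a b where "0 < a" "lp_le p x a" "0 < b" "lp_le p y b"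
    using assms(2,3) unfolding in_lp_iff[OF assms(1)] by blast
  then have "lp_le p (\<lambda>i. x i + y i) (a + b)" "0 < a + b"
    using lp_le_add[OF assms(1)] by auto
  then show ?thesis unfolding in_lp_iff[OF assms(1)] by blast
qed

lemma in_lp_0: "in_lp p (\<lambda>i. 0)"
  by (simp add: in_lp_def image_constant_conv)

lemma lp_norm_0: "lp_norm p (\<lambda>i. 0) = 0"
  by (simp add: lp_norm_def)

lemma in_lp_scale: "in_lp p (\<lambda>i. k * c i)" if "1 \<le> p" "in_lp p c"
proof (cases "k = 0")
  case False
  then show ?thesis
    using that(2) lp_le_scale[OF that(1)] unfolding in_lp_iff[OF that(1)]
    by (metis mult_pos_pos zero_less_norm_iff)
qed (simp add: in_lp_0)

lemma lp_norm_triangle: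
  assumes "1 \<le> p" "in_lp p x" "in_lp p y"
  shows "lp_norm p (\<lambda>i. x i + y i) \<le> lp_norm p x + lp_norm p y"
proof (rule field_le_epsilon)
  fix e :: real assume "0 < e"
  let ?a = "lp_norm p x + e / 2" and ?b = "lp_norm p y + e / 2"
  have "0 < ?a" "lp_le p x ?a" "0 < ?b" "lp_le p y ?b"
    using in_lp_imp_lp_le[OF assms(1,2), of ?a] in_lp_imp_lp_le[OF assms(1,3), of ?b] \<open>0 < e\<close>
    by auto
  then have "lp_le p (\<lambda>i. x i + y i) (?a + ?b)" "0 < ?a + ?b"
    using lp_le_add[OF assms(1)] by (blast intro: add_pos_pos)+
  then show "lp_norm p (\<lambda>i. x i + y i) \<le> lp_norm p x + lp_norm p y + e"
    using lp_le_iff[OF assms(1), of "?a + ?b" "\<lambda>i. x i + y i"] by simp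
qed

lemma lp_norm_scale_le:
  assumes "1 \<le> p" "in_lp p c"
  shows "lp_norm p (\<lambda>i. k * c i) \<le> norm k * lp_norm p c"
proof (cases "k = 0")
  case True
  then show ?thesis by (simp add: lp_norm_0)
next
  case False
  show ?thesis
  proof (rule field_le_epsilon)
    fix e :: real assume "0 < e"
    let ?a = "lp_norm p c + e / norm k"
    have "lp_norm p c < ?a" using False \<open>0 < e\<close> by simp
    then have "0 < ?a" "lp_le p c ?a"
      using in_lp_imp_lp_le[OF assms] by auto
    then have "lp_le p (\<lambda>i. k * c i) (norm k * ?a)" "0 < norm k * ?a"
      using lp_le_scale[OF assms(1)] False by auto
    then show "lp_norm p (\<lambda>i. k * c i) \<le> norm k * lp_norm p c + e"
      using lp_le_iff[OF assms(1), of "norm k * ?a" "\<lambda>i. k * c i"] False by (simp add: distrib_left)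
  qed
qed

lemma lp_norm_scale:
  assumes "1 \<le> p" "in_lp p c"
  shows "lp_norm p (\<lambda>i. k * c i) = norm k * lp_norm p c"
proof (cases "k = 0")
  case False
  \<comment> \<open>The reverse inequality is the one already proved, applied to k c and the factor
    1/k.\<close>
  have "lp_norm p (\<lambda>i. inverse k * (k * c i)) \<le> norm (inverse k) * lp_norm p (\<lambda>i. k * c i)"
    by (intro lp_norm_scale_le in_lp_scale assms)
  then have "norm k * lp_norm p c \<le> lp_norm p (\<lambda>i. k * c i)"
    using False by (simp add: mult.assoc[symmetric] norm_divide field_simps)
  then show ?thesis
    using lp_norm_scale_le[OF assms, of k] by simp
qed (simp add: lp_norm_0)

text \<open>The contraction of l^1 into l^p: each entry is at most \<open>a\<close> in modulus,
  hence |c|^P \<le> |c| a^(P-1), and summation gives a^P.\<close>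

lemma lp_le_sum:
  assumes "1 \<le> p" "0 < a" and le: "\<And>F. finite F \<Longrightarrow> (\<Sum>i\<in>F. norm (c i)) \<le> a"
  shows "lp_le p c a"
proof (cases "p = \<infinity>")
  case True
  have "norm (c i) \<le> a" for i using le[of "{i}"] by simp
  with True show ?thesis by (simp add: lp_le_def)
next
  case False
  define P where "P = real_of_ereal p"
  have P: "1 \<le> P" using one_le_real_of_ereal[OF assms(1) False] by (simp add: P_def)
  have "(\<Sum>i\<in>F. norm (c i) powr P) \<le> a powr P" if "finite F" for F
  proof -
    have "(\<Sum>i\<in>F. norm (c i) powr P) \<le> (\<Sum>i\<in>F. norm (c i) * a powr (P - 1))"
    proof (rule sum_mono)
      fix i
      have "norm (c i) \<le> a" using le[of "{i}"] by simp
      have "norm (c i) powr P = norm (c i) * norm (c i) powr (P - 1)"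
        using P powr_mult_base[of "norm (c i)" "P - 1"] by simp
      also have "\<dots> \<le> norm (c i) * a powr (P - 1)"
        using \<open>norm (c i) \<le> a\<close> P by (intro mult_left_mono powr_mono2) auto
      finally show "norm (c i) powr P \<le> norm (c i) * a powr (P - 1)" .
    qed
    also have "\<dots> \<le> a * a powr (P - 1)"
      unfolding sum_distrib_right[symmetric] using le[OF that] by (intro mult_right_mono) auto
    also have "\<dots> = a powr P"
      using assms(2) powr_mult_base[of a "P - 1"] by simp
    finally show ?thesis .
  qed
  with False show ?thesis by (simp add: lp_le_def P_def)
qed

lemma summable_imp_in_lp:
  assumes "1 \<le> p" and s: "(\<lambda>i. norm (c i)) summable_on UNIV"
  shows "in_lp p c" and "lp_norm p c \<le> (\<Sum>\<^sub>\<infinity>i. norm (c i))"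
proof -
  let ?S = "\<Sum>\<^sub>\<infinity>i. norm (c i)"
  have nn: "0 \<le> ?S" by (intro infsum_nonneg) auto
  have le: "(\<Sum>i\<in>F. norm (c i)) \<le> ?S" if "finite F" for F
    using that s by (intro finite_sum_le_infsum) auto
  have *: "in_lp p c \<and> lp_norm p c \<le> a" if "?S < a" for a
  proof -
    have "0 < a" using that nn by simp
    moreover have "lp_le p c a"
      using le that by (intro lp_le_sum assms(1) \<open>0 < a\<close>) force
    ultimately show ?thesis using lp_le_iff[OF assms(1)] by blast
  qed
  show "in_lp p c" using *[of "?S + 1"] by simp
  show "lp_norm p c \<le> ?S"
  proof (rule dense_ge)
    fix a assume "?S < a"
    with *[of a] show "lp_norm p c \<le> a" by simp
  qed
qed

subsection \<open>Neighbourhoods of zero and continuous linear maps\<close>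

lemma openin_seminorm_ball:
  assumes "q \<in> Q" "x \<in> E" "0 < \<epsilon>"
  shows "openin (seminorm_topology E Q) {y \<in> E. q (y - x) < \<epsilon>}"
  unfolding seminorm_topology_def using assms by (intro topology_generated_by_Basis) blast

text \<open>Subbasic balls may be centred anywhere. If the ball of radius \<epsilon> around x
  contains 0, then by the triangle inequality it contains the ball of radius \<epsilon> - q(-x)
  around 0; finite intersections and unions follow by induction on the generated topology.\<close>

lemma seminorm_topology_nhd_0:
  assumes "openin (seminorm_topology E {q}) U" "0 \<in> U"
    and neg: "\<And>x. x \<in> E \<Longrightarrow> - x \<in> E"
    and tri: "\<And>x y. x \<in> E \<Longrightarrow> y \<in> E \<Longrightarrow> q (x + y) \<le> q x + q y"
  shows "\<exists>\<delta>>0. \<forall>y\<in>E. q y < \<delta> \<longrightarrow> y \<in> U"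
proof -
  define B where "B = insert E {{y \<in> E. q' (y - x) < \<epsilon>} |q' x \<epsilon>. q' \<in> {q} \<and> x \<in> E \<and> 0 < \<epsilon>}"
  have "generate_topology_on B U"
    using assms(1) unfolding seminorm_topology_def B_def openin_topology_generated_by_iff by simp
  then have "0 \<in> U \<longrightarrow> (\<exists>\<delta>>0. \<forall>y\<in>E. q y < \<delta> \<longrightarrow> y \<in> U)"
  proof induction
    case (Int a b)
    show ?case
    proof
      assume "0 \<in> a \<inter> b"
      then obtain d e where "d > 0" "\<forall>y\<in>E. q y < d \<longrightarrow> y \<in> a" "e > 0" "\<forall>y\<in>E. q y < e \<longrightarrow> y \<in> b"
        using Int by blast
      then show "\<exists>\<delta>>0. \<forall>y\<in>E. q y < \<delta> \<longrightarrow> y \<in> a \<inter> b"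
        by (intro exI[of _ "min d e"]) auto
    qed
  next
    case (UN K)
    then show ?case by blast
  next
    case (Basis V)
    show ?case
    proof
      assume "0 \<in> V"
      from Basis consider "V = E" | x \<epsilon> where "V = {y \<in> E. q (y - x) < \<epsilon>}" "x \<in> E"
        unfolding B_def by blast
      then show "\<exists>\<delta>>0. \<forall>y\<in>E. q y < \<delta> \<longrightarrow> y \<in> V"
      proof cases
        case 1
        then show ?thesis by (intro exI[of _ 1]) auto
      next
        case 2
        have "q (- x) < \<epsilon>" using \<open>0 \<in> V\<close> 2 by simp
        moreover have "q (y - x) \<le> q y + q (- x)" if "y \<in> E" for y
          using tri[OF that neg[OF 2(2)]] by simp
        ultimately show ?thesis
          by (intro exI[of _ "\<epsilon> - q (- x)"]) (force simp: 2(1))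
      qed
    qed
  qed simp
  with assms(2) show ?thesis by blast
qed

lemma openin_seminorm_topologyI:
  assumes "V \<subseteq> E" "q 0 = 0"
    and "\<And>x. x \<in> V \<Longrightarrow> \<exists>\<delta>>0. \<forall>y\<in>E. q (y - x) < \<delta> \<longrightarrow> y \<in> V"
  shows "openin (seminorm_topology E {q}) V"
proof (subst openin_subopen, intro ballI)
  fix x assume x: "x \<in> V"
  then obtain d where d: "d > 0" "\<forall>y\<in>E. q (y - x) < d \<longrightarrow> y \<in> V"
    using assms(3) by blast
  have "openin (seminorm_topology E {q}) {y \<in> E. q (y - x) < d}"
    using x assms(1) d(1) by (intro openin_seminorm_ball) auto
  moreover have "x \<in> {y \<in> E. q (y - x) < d}"
    using x assms(1,2) d(1) by auto
  ultimately show "\<exists>T. openin (seminorm_topology E {q}) T \<and> x \<in> T \<and> T \<subseteq> V"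
    using d(2) by blast
qed

section \<open>Universal properties of projective and inductive limits\<close>

lemma continuous_map_inductive_limit_inclusion:
  assumes "X \<in> \<X>"
  shows "continuous_map X (inductive_limit \<X>) (\<lambda>c. c)"
  unfolding inductive_limit_def
proof (rule continuous_on_generated_topo)
  fix U
  assume "U \<in> {U. \<exists>Y. locally_convex (\<Union>X\<in>\<X>. topspace X) Y \<and>
    (\<forall>X\<in>\<X>. continuous_map X Y (\<lambda>c. c)) \<and> openin Y U}"
  then obtain Y where "continuous_map X Y (\<lambda>c. c)" "openin Y U"
    using assms by blast
  then show "openin X ((\<lambda>c. c) -` U \<inter> topspace X)"
    unfolding continuous_map_alt by blast
next
  have "topspace X \<subseteq> topspace (inductive_limit \<X>)"
    using assms by (auto simp: topspace_inductive_limit)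
  then show "(\<lambda>c. c) ` topspace X \<subseteq> \<Union> {U. \<exists>Y. locally_convex (\<Union>X\<in>\<X>. topspace X) Y \<and>
    (\<forall>X\<in>\<X>. continuous_map X Y (\<lambda>c. c)) \<and> openin Y U}"
    unfolding inductive_limit_def topology_generated_by_topspace by simp
qed

text \<open>\<open>Y\<close> is itself one of the topologies whose supremum defines the inductive
  limit. In this way a seminorm that is continuous on every step becomes continuous on the
  limit.\<close>

lemma continuous_map_from_inductive_limit_id:
  assumes lc: "locally_convex (\<Union>X\<in>\<X>. topspace X) Y"
    and cont: "\<And>X. X \<in> \<X> \<Longrightarrow> continuous_map X Y (\<lambda>c. c)"
  shows "continuous_map (inductive_limit \<X>) Y (\<lambda>c. c)"
proof -
  have top: "topspace Y = (\<Union>X\<in>\<X>. topspace X)"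
    using lc by (auto simp: locally_convex_def)
  have "openin (inductive_limit \<X>) U" if "openin Y U" for U
    unfolding inductive_limit_def using lc cont that
    by (intro topology_generated_by_Basis) blast
  moreover have "U \<inter> topspace (inductive_limit \<X>) = U" if "openin Y U" for U
    using openin_subset[OF that] by (simp add: top topspace_inductive_limit Int_absorb2)
  ultimately show ?thesis
    unfolding continuous_map_alt by (simp add: top topspace_inductive_limit)
qed

lemma continuous_map_projective_limit_inclusion:
  assumes "X \<in> \<X>"
  shows "continuous_map (projective_limit \<X>) X (\<lambda>c. c)"
proof -
  have top: "topspace (projective_limit \<X>) = (\<Inter>X\<in>\<X>. topspace X)"
    using assms by (intro topspace_projective_limit) auto
  have "openin (projective_limit \<X>) (U \<inter> (\<Inter>X\<in>\<X>. topspace X))" if "openin X U" for U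
    unfolding projective_limit_def using that assms by (intro topology_generated_by_Basis) blast
  then show ?thesis
    unfolding continuous_map_alt using assms by (auto simp: top)
qed

section \<open>Weighted l^1 norms and neighbourhoods of zero\<close>

text \<open>The weighted l^1 norm. The infinite sum defaults to 0 on sequences that are not
  summable, so the value carries information only together with \<open>wsummable\<close>.\<close>

definition wsum :: "('i \<Rightarrow> real) \<Rightarrow> ('i \<Rightarrow> complex) \<Rightarrow> real" where
  "wsum w c = (\<Sum>\<^sub>\<infinity>\<alpha>. norm (c \<alpha>) * w \<alpha>)"

definition wsummable :: "('i \<Rightarrow> real) \<Rightarrow> ('i \<Rightarrow> complex) \<Rightarrow> bool" where
  "wsummable w c \<longleftrightarrow> (\<lambda>\<alpha>. norm (c \<alpha>) * w \<alpha>) summable_on UNIV"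

lemma wsum_nonneg: "(\<And>\<alpha>. 0 \<le> w \<alpha>) \<Longrightarrow> 0 \<le> wsum w c"
  unfolding wsum_def by (intro infsum_nonneg) auto

lemma wsummable_scale: "wsummable w c \<Longrightarrow> wsummable w (\<lambda>\<alpha>. k * c \<alpha>)"
  unfolding wsummable_def by (auto simp: norm_mult mult.assoc intro: summable_on_cmult_right)

lemma wsum_scale: "wsum w (\<lambda>\<alpha>. k * c \<alpha>) = norm k * wsum w c"
  unfolding wsum_def by (simp add: norm_mult mult.assoc infsum_cmult_right')

lemma wsummable_imp_in_lp:
  assumes "1 \<le> p" "\<And>\<alpha>. 0 \<le> w \<alpha>" "wsummable w c"
  shows "in_lp p (\<lambda>\<alpha>. c \<alpha> * of_real (w \<alpha>))" "lp_norm p (\<lambda>\<alpha>. c \<alpha> * of_real (w \<alpha>)) \<le> wsum w c"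
  using summable_imp_in_lp[OF assms(1), of "\<lambda>\<alpha>. c \<alpha> * of_real (w \<alpha>)"] assms(2,3)
  by (simp_all add: norm_mult wsum_def wsummable_def)

lemma topspace_weighted_lp: "topspace (weighted_lp p w) = {c. in_lp p (\<lambda>\<alpha>. c \<alpha> * of_real (w \<alpha>))}"
  by (simp add: weighted_lp_def)

text \<open>The weighted l^1 norm dominates the weighted l^p norm, so every neighbourhood of 0
  contains an l^1 ball.\<close>

lemma weighted_lp_nhd_0:
  assumes p: "1 \<le> p" and w: "\<And>\<alpha>. 0 \<le> w \<alpha>" and U: "openin (weighted_lp p w) U" "0 \<in> U"
  shows "\<exists>\<delta>>0. \<forall>c. wsummable w c \<longrightarrow> wsum w c < \<delta> \<longrightarrow> c \<in> U"
proof -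
  let ?E = "{c. in_lp p (\<lambda>\<alpha>. c \<alpha> * of_real (w \<alpha>))}" and ?q = "\<lambda>c. lp_norm p (\<lambda>\<alpha>. c \<alpha> * of_real (w \<alpha>))"
  have "\<exists>\<delta>>0. \<forall>c\<in>?E. ?q c < \<delta> \<longrightarrow> c \<in> U"
  proof (rule seminorm_topology_nhd_0)
    show "openin (seminorm_topology ?E {?q}) U" using U(1) by (simp add: weighted_lp_def)
    show "- x \<in> ?E" if "x \<in> ?E" for x
      using in_lp_scale[OF p, of "\<lambda>\<alpha>. x \<alpha> * of_real (w \<alpha>)" "-1"] that by simp
    show "?q (x + y) \<le> ?q x + ?q y" if "x \<in> ?E" "y \<in> ?E" for x y
      using lp_norm_triangle[OF p, of "\<lambda>\<alpha>. x \<alpha> * of_real (w \<alpha>)" "\<lambda>\<alpha>. y \<alpha> * of_real (w \<alpha>)"] that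
      by (simp add: distrib_right)
  qed fact
  then obtain d where "d > 0" "\<forall>c\<in>?E. ?q c < d \<longrightarrow> c \<in> U" by blast
  then show ?thesis
    using wsummable_imp_in_lp[OF p w] by (intro exI[of _ d]) force
qed

text \<open>A basic neighbourhood involves finitely many radii. Since the weights increase with the
  radius, the norm with the largest radius controls the others, and one pair of r and \<delta>
  suffices.\<close>

lemma projective_limit_nhd_0:
  fixes p :: ereal and w :: "real \<Rightarrow> 'n::finite mindex \<Rightarrow> real"
  defines "\<X> \<equiv> (\<lambda>r. weighted_lp p (w r)) ` {0<..}"
  defines "E \<equiv> \<Inter>X\<in>\<X>. topspace X"
  assumes p: "1 \<le> p" and w: "\<And>r \<alpha>. 0 < r \<Longrightarrow> 0 \<le> w r \<alpha>"
    and mono: "\<And>r r' \<alpha>. 0 < r \<Longrightarrow> r \<le> r' \<Longrightarrow> w r \<alpha> \<le> w r' \<alpha>"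
    and s: "\<And>c r. c \<in> E \<Longrightarrow> 0 < r \<Longrightarrow> wsummable (w r) c"
    and U: "openin (projective_limit \<X>) U" "0 \<in> U"
  shows "\<exists>r>0. \<exists>\<delta>>0. \<forall>c\<in>E. wsum (w r) c < \<delta> \<longrightarrow> c \<in> U"
proof -
  have le: "wsum (w r) c \<le> wsum (w r') c" if "0 < r" "r \<le> r'" "c \<in> E" for r r' c
    unfolding wsum_def using s[of c r] s[of c r'] mono[OF that(1,2)] that
    by (intro infsum_mono) (auto simp: wsummable_def intro: mult_left_mono)
  have "generate_topology_on {U \<inter> E |U. \<exists>X\<in>\<X>. openin X U} U"
    using U(1) unfolding projective_limit_def openin_topology_generated_by_iff E_def .
  then have "0 \<in> U \<longrightarrow> (\<exists>r>0. \<exists>\<delta>>0. \<forall>c\<in>E. wsum (w r) c < \<delta> \<longrightarrow> c \<in> U)"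
  proof induction
    case (Int a b)
    show ?case
    proof
      assume "0 \<in> a \<inter> b"
      then obtain r d r' e where *: "r > 0" "d > 0" "\<forall>c\<in>E. wsum (w r) c < d \<longrightarrow> c \<in> a"
        "r' > 0" "e > 0" "\<forall>c\<in>E. wsum (w r') c < e \<longrightarrow> c \<in> b"
        using Int by blast
      have "c \<in> a \<inter> b" if "c \<in> E" "wsum (w (max r r')) c < min d e" for c
        using * that le[of r "max r r'" c] le[of r' "max r r'" c] by force
      then show "\<exists>r>0. \<exists>\<delta>>0. \<forall>c\<in>E. wsum (w r) c < \<delta> \<longrightarrow> c \<in> a \<inter> b"
        using * by (intro exI[of _ "max r r'"] conjI exI[of _ "min d e"]) auto
    qed
  next
    case (UN K)
    then show ?case by blast
  next
    case (Basis V)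
    show ?case
    proof
      assume "0 \<in> V"
      from Basis obtain U r where V: "V = U \<inter> E" "r > 0" "openin (weighted_lp p (w r)) U"
        by (auto simp: \<X>_def)
      then obtain d where "d > 0" "\<forall>c. wsummable (w r) c \<longrightarrow> wsum (w r) c < d \<longrightarrow> c \<in> U"
        using weighted_lp_nhd_0[OF p, of "w r" U] w[OF V(2)] \<open>0 \<in> V\<close> by blast
      then show "\<exists>r>0. \<exists>\<delta>>0. \<forall>c\<in>E. wsum (w r) c < \<delta> \<longrightarrow> c \<in> V"
        using V s by blast
    qed
  qed simp
  with U(2) show ?thesis by blast
qed

section \<open>From continuity to estimates\<close>

text \<open>Scaling: for M > \<nu>(c)/d the multiple c/M has \<nu> below d, so q(c) \<le> M. Working
  with M above \<nu>(c)/d keeps the divisor positive even when \<nu>(c) = 0.\<close>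

lemma homogeneous_bound:
  fixes q \<nu> :: "('i \<Rightarrow> complex) \<Rightarrow> real"
  assumes d: "0 < d" and small: "\<And>c. c \<in> E \<Longrightarrow> \<nu> c < d \<Longrightarrow> q c \<le> 1"
    and E: "\<And>c k. c \<in> E \<Longrightarrow> (\<lambda>i. k * c i) \<in> E"
    and \<nu>: "\<And>c k. c \<in> E \<Longrightarrow> \<nu> (\<lambda>i. k * c i) = norm k * \<nu> c" and nn: "\<And>c. c \<in> E \<Longrightarrow> 0 \<le> \<nu> c"
    and q: "\<And>c k. c \<in> E \<Longrightarrow> q (\<lambda>i. k * c i) = norm k * q c"
    and c: "c \<in> E"
  shows "q c \<le> \<nu> c / d"
proof (rule dense_ge)
  fix M assume M: "\<nu> c / d < M"
  have "0 \<le> \<nu> c / d" using nn[OF c] d by simp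
  with M have "0 < M" by linarith
  define k :: complex where "k = of_real (1 / M)"
  have k: "norm k = 1 / M" using \<open>0 < M\<close> by (simp add: k_def norm_divide)
  have "\<nu> (\<lambda>i. k * c i) < d"
    using M d \<open>0 < M\<close> by (simp add: \<nu>[OF c] k field_simps)
  then have "q (\<lambda>i. k * c i) \<le> 1"
    by (intro small E c)
  then show "q c \<le> M"
    using \<open>0 < M\<close> by (simp add: q[OF c] k field_simps)
qed

lemma clinear_on_zero:
  assumes "clinear_on E S" "c \<in> E"
  shows "S 0 = 0"
proof -
  have "S (\<lambda>\<alpha>. 0 * c \<alpha>) = (\<lambda>\<alpha>. 0 * S c \<alpha>)"
    using assms unfolding clinear_on_def by blast
  then show ?thesis by (simp add: zero_fun_def)
qed

lemma clinear_on_scale: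
  "clinear_on E S \<Longrightarrow> c \<in> E \<Longrightarrow> S (\<lambda>\<alpha>. k * c \<alpha>) = (\<lambda>\<alpha>. k * S c \<alpha>)"
  unfolding clinear_on_def by blast

text \<open>Composition with the inclusion of the step r and the map onto the step R makes S a
  continuous linear map between two normed spaces, hence bounded. The constant may depend on r and
  R, which are both arbitrary. Entries of S c are bounded by its norm.\<close>

lemma continuous_inductive_to_projective_bound:
  fixes p :: ereal and w v :: "real \<Rightarrow> 'n::finite mindex \<Rightarrow> real"
  defines "\<X> \<equiv> (\<lambda>r. weighted_lp p (w r)) ` {0<..}"
  defines "\<Y> \<equiv> (\<lambda>r. weighted_lp p (\<lambda>\<alpha>. 1 / v r \<alpha>)) ` {0<..}"
  assumes p: "1 \<le> p" and w: "\<And>\<alpha>. 0 \<le> w r \<alpha>" and v: "\<And>\<alpha>. 0 < v R \<alpha>"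
    and cont: "continuous_map (inductive_limit \<X>) (projective_limit \<Y>) S"
    and lin: "clinear_on (\<Union>X\<in>\<X>. topspace X) S"
    and r: "0 < r" and R: "0 < R"
  shows "\<exists>C\<ge>0. \<forall>c. wsummable (w r) c \<longrightarrow> (\<forall>\<alpha>. norm (S c \<alpha>) \<le> C * v R \<alpha> * wsum (w r) c)"
proof -
  let ?X = "weighted_lp p (w r)" and ?Y = "weighted_lp p (\<lambda>\<alpha>. 1 / v R \<alpha>)"
  let ?q = "\<lambda>y. lp_norm p (\<lambda>\<alpha>. y \<alpha> * of_real (1 / v R \<alpha>))"
  have X: "?X \<in> \<X>" and Y: "?Y \<in> \<Y>" using r R by (auto simp: \<X>_def \<Y>_def)
  have "continuous_map ?X ?Y ((\<lambda>c. c) \<circ> (S \<circ> (\<lambda>c. c)))"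
    using cont continuous_map_inductive_limit_inclusion[OF X] continuous_map_projective_limit_inclusion[OF Y]
    by (meson continuous_map_compose)
  then have XY: "continuous_map ?X ?Y S" by (simp add: o_def)
  \<comment> \<open>The open unit ball, written with \<open>y - 0\<close> to match the form of the
    subbasic sets.\<close>
  define U where "U = {y \<in> topspace ?Y. ?q (y - 0) < 1}"
  have "0 \<in> topspace ?Y" by (simp add: topspace_weighted_lp in_lp_0)
  then have "openin ?Y U"
    unfolding U_def weighted_lp_def topspace_seminorm_topology
    by (intro openin_seminorm_ball[where q = ?q]) auto
  then have open_pre: "openin ?X (S -` U \<inter> topspace ?X)"
    using XY unfolding continuous_map_alt by blast
  have "0 \<in> topspace ?X" by (simp add: topspace_weighted_lp in_lp_0)
  moreover from this have "S 0 = 0"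
    using X by (intro clinear_on_zero[OF lin]) auto
  ultimately have "0 \<in> S -` U \<inter> topspace ?X"
    by (simp add: U_def topspace_weighted_lp in_lp_0 lp_norm_0)
  then obtain d where d: "d > 0"
    "\<And>c. wsummable (w r) c \<Longrightarrow> wsum (w r) c < d \<Longrightarrow> c \<in> S -` U \<inter> topspace ?X"
    using weighted_lp_nhd_0[OF p w open_pre] by blast
  have "norm (S c \<alpha>) / v R \<alpha> \<le> wsum (w r) c / d" if "wsummable (w r) c" for c \<alpha>
  proof (rule homogeneous_bound[where E = "{c. wsummable (w r) c}" and q = "\<lambda>c. norm (S c \<alpha>) / v R \<alpha>"])
    fix c assume "c \<in> {c. wsummable (w r) c}" "wsum (w r) c < d"
    then have "S c \<in> U" using d(2) by blast
    then have "norm (S c \<alpha> * of_real (1 / v R \<alpha>)) \<le> ?q (S c)" "?q (S c) < 1"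
      by (auto simp: U_def topspace_weighted_lp intro!: norm_le_lp_norm[OF p])
    moreover have "norm (S c \<alpha> * of_real (1 / v R \<alpha>)) = norm (S c \<alpha>) / v R \<alpha>"
      using v[of \<alpha>] by (simp add: norm_divide)
    ultimately show "norm (S c \<alpha>) / v R \<alpha> \<le> 1" by linarith
  next
    fix c k assume "c \<in> {c. wsummable (w r) c}"
    then have "c \<in> (\<Union>X\<in>\<X>. topspace X)"
      using X wsummable_imp_in_lp(1)[OF p w] by (force simp: topspace_weighted_lp)
    then show "norm (S (\<lambda>i. k * c i) \<alpha>) / v R \<alpha> = norm k * (norm (S c \<alpha>) / v R \<alpha>)"
      using clinear_on_scale[OF lin] by (simp add: norm_mult)
  qed (use d w that in \<open>auto simp: wsummable_scale wsum_scale wsum_nonneg\<close>)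
  then show ?thesis
    using d(1) v by (intro exI[of _ "1 / d"]) (auto simp: field_simps)
qed

text \<open>Boundedness of u v_R for every R makes q(c) = sup |c_\<alpha>| u_\<alpha> finite and
  continuous on each step of the inductive limit, hence continuous on the limit. Then q(S c) is
  continuous on the projective limit and is controlled by a single radius r, which depends on
  u.\<close>

lemma continuous_projective_to_inductive_bound:
  fixes p :: ereal and w v :: "real \<Rightarrow> 'n::finite mindex \<Rightarrow> real" and u :: "'n mindex \<Rightarrow> real"
  defines "\<X> \<equiv> (\<lambda>r. weighted_lp p (w r)) ` {0<..}"
  defines "\<Y> \<equiv> (\<lambda>r. weighted_lp p (\<lambda>\<alpha>. 1 / v r \<alpha>)) ` {0<..}"
  defines "E \<equiv> \<Inter>X\<in>\<X>. topspace X"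
  assumes p: "1 \<le> p" and w: "\<And>r \<alpha>. 0 < r \<Longrightarrow> 0 \<le> w r \<alpha>" and v: "\<And>r \<alpha>. 0 < r \<Longrightarrow> 0 < v r \<alpha>"
    and mono: "\<And>r r' \<alpha>. 0 < r \<Longrightarrow> r \<le> r' \<Longrightarrow> w r \<alpha> \<le> w r' \<alpha>"
    and s: "\<And>c r. c \<in> E \<Longrightarrow> 0 < r \<Longrightarrow> wsummable (w r) c"
    and cont: "continuous_map (projective_limit \<X>) (inductive_limit \<Y>) S"
    and lin: "clinear_on E S"
    and u: "\<And>\<alpha>. 0 \<le> u \<alpha>" and uv: "\<And>R. 0 < R \<Longrightarrow> \<exists>M. \<forall>\<alpha>. u \<alpha> * v R \<alpha> \<le> M"
  shows "\<exists>r>0. \<exists>C\<ge>0. \<forall>c\<in>E. \<forall>\<alpha>. norm (S c \<alpha>) * u \<alpha> \<le> C * wsum (w r) c"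
proof -
  define E' where "E' = (\<Union>Y\<in>\<Y>. topspace Y)"
  define q where "q = (\<lambda>c. lp_norm \<infinity> (\<lambda>\<alpha>. c \<alpha> * complex_of_real (u \<alpha>)))"
  define Z where "Z = seminorm_topology E' {q}"
  have topE: "topspace (projective_limit \<X>) = E"
    unfolding E_def by (rule topspace_projective_limit) (auto simp: \<X>_def)
  have E_iff: "c \<in> E \<longleftrightarrow> (\<forall>r>0. in_lp p (\<lambda>\<alpha>. c \<alpha> * of_real (w r \<alpha>)))" for c
    by (auto simp: E_def \<X>_def topspace_weighted_lp)
  have E_scale: "(\<lambda>i. k * c i) \<in> E" if "c \<in> E" for c k
    unfolding E_iff
  proof (intro allI impI)
    fix r :: real assume "0 < r"
    then show "in_lp p (\<lambda>\<alpha>. k * c \<alpha> * of_real (w r \<alpha>))"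
      using that in_lp_scale[OF p, of "\<lambda>\<alpha>. c \<alpha> * of_real (w r \<alpha>)" k]
      by (simp add: E_iff mult.assoc)
  qed
  \<comment> \<open>The entry |c_\<alpha>| u_\<alpha> is split as (u_\<alpha> v_R(\<alpha>)) times
    |c_\<alpha>| / v_R(\<alpha>); the first factor is at most M, the second at most the norm of the
    step R.\<close>
  have key: "in_lp \<infinity> (\<lambda>\<alpha>. c \<alpha> * complex_of_real (u \<alpha>)) \<and>
      q c \<le> M * lp_norm p (\<lambda>\<alpha>. c \<alpha> * of_real (1 / v R \<alpha>))"
    if R: "0 < R" and M: "0 \<le> M" "\<And>\<alpha>. u \<alpha> * v R \<alpha> \<le> M"
      and c: "in_lp p (\<lambda>\<alpha>. c \<alpha> * of_real (1 / v R \<alpha>))" for R M c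
  proof -
    let ?N = "lp_norm p (\<lambda>\<alpha>. c \<alpha> * of_real (1 / v R \<alpha>))"
    have pt: "norm (c \<alpha> * complex_of_real (u \<alpha>)) \<le> M * ?N" for \<alpha>
    proof -
      have "norm (c \<alpha> * of_real (1 / v R \<alpha>)) \<le> ?N"
        by (rule norm_le_lp_norm[OF p c])
      then have "(u \<alpha> * v R \<alpha>) * norm (c \<alpha> * of_real (1 / v R \<alpha>)) \<le> M * ?N"
        using M u[of \<alpha>] v[OF R, of \<alpha>] by (intro mult_mono) auto
      moreover have "(u \<alpha> * v R \<alpha>) * norm (c \<alpha> * of_real (1 / v R \<alpha>)) = norm (c \<alpha> * complex_of_real (u \<alpha>))"
        using u[of \<alpha>] v[OF R, of \<alpha>] by (simp add: norm_mult norm_divide)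
      ultimately show ?thesis by simp
    qed
    then have "in_lp \<infinity> (\<lambda>\<alpha>. c \<alpha> * complex_of_real (u \<alpha>))"
      by (auto simp: in_lp_def bounded_iff)
    moreover have "q c \<le> M * ?N"
    proof -
      have "q c = (SUP \<alpha>. norm (c \<alpha> * complex_of_real (u \<alpha>)))" by (simp add: q_def lp_norm_def)
      also have "\<dots> \<le> M * ?N" using pt by (intro cSUP_least) auto
      finally show ?thesis .
    qed
    ultimately show ?thesis by blast
  qed
  have bound: "\<exists>M\<ge>0. \<forall>\<alpha>. u \<alpha> * v R \<alpha> \<le> M" if "0 < R" for R
    using uv[OF that] by (meson linear order_trans)
  have in_inf: "in_lp \<infinity> (\<lambda>\<alpha>. c \<alpha> * complex_of_real (u \<alpha>))" if "c \<in> E'" for c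
  proof -
    from that obtain R where "0 < R" "in_lp p (\<lambda>\<alpha>. c \<alpha> * of_real (1 / v R \<alpha>))"
      by (auto simp: E'_def \<Y>_def topspace_weighted_lp)
    then show ?thesis using key bound by blast
  qed
  \<comment> \<open>Stated for all sequences whose product with u is bounded, so that it applies to
    differences without showing that they lie in the union \<open>E'\<close>.\<close>
  have tri: "q (x + y) \<le> q x + q y"
    if "in_lp \<infinity> (\<lambda>\<alpha>. x \<alpha> * complex_of_real (u \<alpha>))" "in_lp \<infinity> (\<lambda>\<alpha>. y \<alpha> * complex_of_real (u \<alpha>))" for x y
    using lp_norm_triangle[OF _ that] by (simp add: q_def distrib_right)
  have "seminorm_on E' q"
    unfolding seminorm_on_def
  proof (intro conjI ballI allI)
    fix x assume x: "x \<in> E'"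
    show "0 \<le> q x" unfolding q_def by (intro lp_norm_nonneg in_inf x)
    show "q (x + y) \<le> q x + q y" if "y \<in> E'" for y
      by (intro tri in_inf x that)
    show "q (\<lambda>i. k * x i) = norm k * q x" for k
      using lp_norm_scale[OF _ in_inf[OF x], of k] by (simp add: q_def mult.assoc)
  qed
  then have lc: "locally_convex E' Z"
    by (auto simp: locally_convex_def Z_def)
  have "continuous_map Y Z (\<lambda>c. c)" if "Y \<in> \<Y>" for Y
  proof -
    from that obtain R where R: "0 < R" and Y: "Y = weighted_lp p (\<lambda>\<alpha>. 1 / v R \<alpha>)"
      by (auto simp: \<Y>_def)
    let ?N = "\<lambda>c. lp_norm p (\<lambda>\<alpha>. c \<alpha> * of_real (1 / v R \<alpha>))"
    let ?F = "{c. in_lp p (\<lambda>\<alpha>. c \<alpha> * of_real (1 / v R \<alpha>))}"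
    from bound[OF R] obtain M where M: "0 \<le> M" "\<And>\<alpha>. u \<alpha> * v R \<alpha> \<le> M" by blast
    have sub: "?F \<subseteq> E'"
      using that by (auto simp: E'_def Y topspace_weighted_lp)
    have F_diff: "x - y \<in> ?F" if "x \<in> ?F" "y \<in> ?F" for x y
      using in_lp_add[OF p, of "\<lambda>\<alpha>. x \<alpha> * of_real (1 / v R \<alpha>)" "\<lambda>\<alpha>. -1 * (y \<alpha> * of_real (1 / v R \<alpha>))"]
        in_lp_scale[OF p, of "\<lambda>\<alpha>. y \<alpha> * of_real (1 / v R \<alpha>)" "-1"] that
      by (simp add: diff_divide_distrib)
    have E'_neg: "in_lp \<infinity> (\<lambda>\<alpha>. (y0 - x) \<alpha> * complex_of_real (u \<alpha>))" if "x \<in> E'" "y0 \<in> E'" for x y0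
      using in_lp_add[of \<infinity>, OF _ in_inf[OF that(2)] in_lp_scale[of \<infinity>, OF _ in_inf[OF that(1)], of "-1"]]
      by (simp add: left_diff_distrib)
    \<comment> \<open>The centre x may lie in a different step, so openness is checked around each
      point \<open>y0\<close> of the ball that lies in the step \<open>?F\<close>.\<close>
    have "openin Y ({y \<in> E'. q (y - x) < \<epsilon>} \<inter> ?F)" if x: "x \<in> E'" for x \<epsilon>
      unfolding Y weighted_lp_def
    proof (rule openin_seminorm_topologyI)
      show "?N 0 = 0" by (simp add: lp_norm_0)
      fix y0 assume "y0 \<in> {y \<in> E'. q (y - x) < \<epsilon>} \<inter> ?F"
      then have y0: "y0 \<in> E'" "q (y0 - x) < \<epsilon>" "y0 \<in> ?F" by auto
      \<comment> \<open>The distance left inside the ball, divided by the Lipschitz constant; M + 1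
        replaces M, which may be 0.\<close>
      define \<delta> where "\<delta> = (\<epsilon> - q (y0 - x)) / (M + 1)"
      have "0 < \<delta>" using y0 M by (simp add: \<delta>_def)
      moreover have "q (y - x) < \<epsilon>" if y: "y \<in> ?F" "?N (y - y0) < \<delta>" for y
      proof -
        have d: "in_lp p (\<lambda>\<alpha>. (y - y0) \<alpha> * of_real (1 / v R \<alpha>))"
          using F_diff[OF y(1) y0(3)] by simp
        have "q (y - x) = q ((y - y0) + (y0 - x))" by simp
        also have "\<dots> \<le> q (y - y0) + q (y0 - x)"
          using key[OF R M d] E'_neg[OF x y0(1)] by (intro tri) auto
        also have "q (y - y0) \<le> M * ?N (y - y0)"
          using key[OF R M d] by blast
        also have "\<dots> \<le> (M + 1) * ?N (y - y0)"
          using lp_norm_nonneg[OF d] by (simp add: distrib_right)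
        also have "\<dots> < (M + 1) * \<delta>"
          using y(2) M(1) by (intro mult_strict_left_mono) auto
        also have "(M + 1) * \<delta> = \<epsilon> - q (y0 - x)"
          using M(1) by (simp add: \<delta>_def)
        finally show ?thesis by (simp only: diff_add_cancel)
      qed
      ultimately show "\<exists>\<delta>>0. \<forall>y\<in>?F. ?N (y - y0) < \<delta> \<longrightarrow> y \<in> {y \<in> E'. q (y - x) < \<epsilon>} \<inter> ?F"
        using sub by (intro exI[of _ \<delta>]) blast
    qed auto
    then show ?thesis
      unfolding Z_def seminorm_topology_def
    proof (intro continuous_on_generated_topo)
      fix U assume "U \<in> insert E' {{y \<in> E'. q' (y - x) < \<epsilon>} |q' x \<epsilon>. q' \<in> {q} \<and> x \<in> E' \<and> 0 < \<epsilon>}"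
      then consider "U = E'" | x \<epsilon> where "x \<in> E'" "U = {y \<in> E'. q (y - x) < \<epsilon>}" by blast
      then show "openin Y ((\<lambda>c. c) -` U \<inter> topspace Y)"
      proof cases
        case 1
        then have "(\<lambda>c. c) -` U \<inter> topspace Y = topspace Y"
          using sub by (auto simp: Y topspace_weighted_lp)
        then show ?thesis by simp
      next
        case 2
        then show ?thesis
          using \<open>\<And>x \<epsilon>. x \<in> E' \<Longrightarrow> openin Y ({y \<in> E'. q (y - x) < \<epsilon>} \<inter> ?F)\<close>[OF 2(1)]
          by (simp add: Y topspace_weighted_lp)
      qed
    qed (use sub in \<open>auto simp: Y topspace_weighted_lp\<close>)
  qed
  then have "continuous_map (inductive_limit \<Y>) Z (\<lambda>c. c)"
    using lc unfolding E'_def by (intro continuous_map_from_inductive_limit_id)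
  from continuous_map_compose[OF cont this] have XZ: "continuous_map (projective_limit \<X>) Z S"
    by (simp add: o_def)
  define U where "U = {y \<in> E'. q (y - 0) < 1}"
  have "0 \<in> E'"
    by (auto simp: E'_def \<Y>_def topspace_weighted_lp in_lp_0 intro: exI[of _ 1])
  then have "openin Z U"
    unfolding U_def Z_def by (rule openin_seminorm_ball[OF singletonI _ zero_less_one])
  then have open_pre: "openin (projective_limit \<X>) (S -` U \<inter> E)"
    using XZ unfolding continuous_map_alt topE by blast
  have "0 \<in> E" by (simp add: E_iff in_lp_0)
  moreover from this have "S 0 = 0" by (rule clinear_on_zero[OF lin])
  moreover have "0 \<in> U"
  proof -
    have "q (0 - 0) < 1" by (simp add: q_def lp_norm_0)
    with \<open>0 \<in> E'\<close> show ?thesis unfolding U_def by blast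
  qed
  ultimately have "0 \<in> S -` U \<inter> E"
    by (simp only: vimage_eq Int_iff)
  then obtain r d where d: "r > 0" "d > 0" "\<And>c. c \<in> E \<Longrightarrow> wsum (w r) c < d \<Longrightarrow> c \<in> S -` U \<inter> E"
    using projective_limit_nhd_0[of p w, folded \<X>_def, folded E_def, OF p w mono s open_pre] by blast
  have "norm (S c \<alpha>) * u \<alpha> \<le> wsum (w r) c / d" if "c \<in> E" for c \<alpha>
  proof (rule homogeneous_bound[where E = E and q = "\<lambda>c. norm (S c \<alpha>) * u \<alpha>"])
    fix c assume "c \<in> E" "wsum (w r) c < d"
    then have "S c \<in> U" using d(3) by blast
    then have "norm (S c \<alpha> * of_real (u \<alpha>)) \<le> q (S c)" "q (S c) < 1"
      unfolding q_def U_def by (auto intro!: norm_le_lp_norm in_inf)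
    then show "norm (S c \<alpha>) * u \<alpha> \<le> 1"
      using u[of \<alpha>] by (simp add: norm_mult)
  next
    fix c k assume "c \<in> E"
    then show "norm (S (\<lambda>i. k * c i) \<alpha>) * u \<alpha> = norm k * (norm (S c \<alpha>) * u \<alpha>)"
      using clinear_on_scale[OF lin] by (simp add: norm_mult)
  qed (use d w that E_scale in \<open>auto simp: wsum_scale wsum_nonneg\<close>)
  then show ?thesis
    using d by (intro exI[of _ r] conjI exI[of _ "1 / d"]) auto
qed

subsection \<open>The weights\<close>

lemma mabs_diff: "mabs (\<kappa> - \<kappa>') + mabs \<kappa>' = mabs \<kappa>" if "\<kappa>' \<le> \<kappa>" for \<kappa> :: "'n::finite mindex"
  using that unfolding mabs_def by (simp add: le_fun_def sum.distrib[symmetric])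

lemma mabs_mono: "\<kappa>' \<le> \<kappa> \<Longrightarrow> mabs \<kappa>' \<le> mabs \<kappa>"
  unfolding mabs_def by (intro sum_mono) (simp add: le_fun_def)

lemma power_mabs: "(\<Prod>i\<in>UNIV. x ^ \<kappa> i) = x ^ mabs \<kappa>" for x :: "'a::comm_monoid_mult"
  by (simp add: mabs_def power_sum)

lemma fact_mult_fact_le: "(fact m :: real) * fact n \<le> fact (m + n)"
proof -
  have "(fact m * fact n :: nat) dvd fact (m + n)"
    by (rule fact_fact_dvd_fact)
  then have "(fact m * fact n :: nat) \<le> fact (m + n)"
    by (rule dvd_imp_le) simp
  then have "real (fact m * fact n) \<le> real (fact (m + n))"
    by (simp only: of_nat_le_iff)
  then show ?thesis by simp
qed

lemma mfact_mult_le: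
  assumes "\<kappa>' \<le> \<kappa>"
  shows "mfact (\<kappa> - \<kappa>') * mfact \<kappa>' \<le> mfact \<kappa>"
  unfolding mfact_def prod.distrib[symmetric]
proof (rule prod_mono, safe)
  fix i
  show "(fact ((\<kappa> - \<kappa>') i) * fact (\<kappa>' i) :: real) \<le> fact (\<kappa> i)"
    using fact_mult_fact_le[of "(\<kappa> - \<kappa>') i" "\<kappa>' i"] assms by (simp add: le_fun_def)
qed simp

lemma power_div_fact_le_exp: "x ^ m / fact m \<le> exp x" if "0 \<le> x" for x :: real
proof -
  have "(\<Sum>n\<in>{m}. x ^ n /\<^sub>R fact n) \<le> (\<Sum>n. x ^ n /\<^sub>R fact n)"
    using that by (intro sum_le_suminf summable_exp_generic) auto
  then show ?thesis by (simp add: exp_def divide_inverse mult.commute)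
qed

text \<open>In one coordinate y^m \<le> e^y m! with y = x^(1/q), raised to the power q. The
  constants multiply over the coordinates.\<close>

lemma power_le_mfact_powr:
  assumes x: "0 < x" and q: "0 < q"
  shows "\<exists>C\<ge>0. \<forall>\<delta> :: 'n::finite mindex. x ^ mabs \<delta> \<le> C * mfact \<delta> powr q"
proof -
  define y where "y = x powr (1 / q)"
  have y: "0 < y" "y powr q = x" using x q by (auto simp: y_def powr_powr)
  define c where "c = exp y powr q"
  have 1: "x ^ m \<le> c * fact m powr q" for m
  proof -
    have "y ^ m \<le> exp y * fact m"
      using power_div_fact_le_exp[of y m] y by (simp add: divide_le_eq)
    then have "(y ^ m) powr q \<le> (exp y * fact m) powr q"
      using y q by (intro powr_mono2) auto
    also have "(y ^ m) powr q = x ^ m"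
      using y by (metis powr_powr_swap powr_realpow zero_less_power powr_gt_zero less_irrefl)
    finally show ?thesis by (simp add: powr_mult c_def)
  qed
  have "x ^ mabs \<delta> \<le> c ^ CARD('n) * mfact \<delta> powr q" for \<delta> :: "'n mindex"
  proof -
    have "x ^ mabs \<delta> = (\<Prod>i\<in>UNIV. x ^ \<delta> i)" by (simp add: power_mabs)
    also have "\<dots> \<le> (\<Prod>i\<in>UNIV. c * fact (\<delta> i) powr q)"
      using x 1 by (intro prod_mono) auto
    also have "\<dots> = c ^ CARD('n) * mfact \<delta> powr q"
      by (simp add: prod.distrib mfact_def prod_powr_distrib)
    finally show ?thesis .
  qed
  then show ?thesis
    by (intro exI[of _ "c ^ CARD('n)"]) (auto simp: c_def)
qed

lemma weight_pos: "0 < r \<Longrightarrow> 0 < weight r s \<alpha>"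
  using mfact_pos[of \<alpha>] by (cases s) auto

lemma weight_mono: "0 < r \<Longrightarrow> r \<le> r' \<Longrightarrow> weight r s \<alpha> \<le> weight r' s \<alpha>"
  by (cases s) (auto intro!: mult_right_mono power_mono)

text \<open>The factor t^|\<kappa>| merely turns r into r t. For r < 1 the weight need not increase
  with the index: passing from \<kappa>' to \<kappa> costs (1/r)^|\<kappa> - \<kappa>'|, which is
  absorbed by a power of (\<kappa> - \<kappa>')!, and (\<kappa> - \<kappa>')! \<kappa>'! \<le>
  \<kappa>!.\<close>

lemma weight_absorb_Flat:
  assumes "0 < \<sigma>" "0 < r" "0 < t"
  shows "\<exists>C\<ge>0. \<forall>\<kappa>' \<kappa> :: 'n::finite mindex. \<kappa>' \<le> \<kappa> \<longrightarrow>
    t ^ mabs \<kappa> * weight r (Flat \<sigma>) \<kappa>' \<le> C * weight (r * t) (Flat \<sigma>) \<kappa>"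
proof -
  define q where "q = 1 / (2 * \<sigma>)"
  obtain C where C: "C \<ge> 0" "\<And>\<delta> :: 'n mindex. (1 / r) ^ mabs \<delta> \<le> C * mfact \<delta> powr q"
    using power_le_mfact_powr[of "1 / r" q] assms by (auto simp: q_def)
  have "t ^ mabs \<kappa> * weight r (Flat \<sigma>) \<kappa>' \<le> C * weight (r * t) (Flat \<sigma>) \<kappa>"
    if le: "\<kappa>' \<le> \<kappa>" for \<kappa>' \<kappa> :: "'n mindex"
  proof -
    have "weight r (Flat \<sigma>) \<kappa>' = r ^ mabs \<kappa> * ((1 / r) ^ mabs (\<kappa> - \<kappa>') * mfact \<kappa>' powr q)"
      using assms mabs_diff[OF le, symmetric] by (simp add: q_def power_add power_divide)
    also have "\<dots> \<le> r ^ mabs \<kappa> * ((C * mfact (\<kappa> - \<kappa>') powr q) * mfact \<kappa>' powr q)"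
      using assms C(2) by (intro mult_left_mono mult_right_mono) auto
    also have "\<dots> = r ^ mabs \<kappa> * (C * (mfact (\<kappa> - \<kappa>') * mfact \<kappa>') powr q)"
      by (simp add: powr_mult mult.assoc)
    also have "\<dots> \<le> r ^ mabs \<kappa> * (C * mfact \<kappa> powr q)"
      using assms C(1) mfact_mult_le[OF le] mfact_pos[of "\<kappa> - \<kappa>'"] mfact_pos[of \<kappa>']
      by (intro mult_left_mono powr_mono2) (auto simp: q_def)
    finally have "t ^ mabs \<kappa> * weight r (Flat \<sigma>) \<kappa>' \<le> t ^ mabs \<kappa> * (r ^ mabs \<kappa> * (C * mfact \<kappa> powr q))"
      using assms by (intro mult_left_mono) auto
    then show ?thesis by (simp add: q_def power_mult_distrib mult_ac)
  qed
  with C(1) show ?thesis by blast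
qed

text \<open>The threshold x solves x^(q-1) = ln t / r. Beyond it n ln t \<le> r n^q; up to it n ln t
  is at most the constant x ln t.\<close>

lemma power_le_exp_powr:
  assumes q: "1 < q" and r: "0 < r" and t: "1 \<le> t"
  shows "\<exists>C\<ge>0. \<forall>n. t ^ n \<le> C * exp (r * real n powr q)"
proof -
  define x where "x = (ln t / r) powr (1 / (q - 1))"
  have lnt: "0 \<le> ln t" using t by simp
  have "t ^ n \<le> exp (x * ln t) * exp (r * real n powr q)" for n
  proof -
    have "real n * ln t \<le> x * ln t + r * real n powr q"
    proof (cases "real n \<le> x")
      case True
      then have "real n * ln t \<le> x * ln t" using lnt by (intro mult_right_mono)
      then show ?thesis using r by (simp add: add_increasing2)
    next
      case False
      then have n: "x < real n" "0 < real n" using powr_ge_zero[of "ln t / r" "1 / (q - 1)"] unfolding x_def by linarith+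
      have "ln t / r = x powr (q - 1)"
        using q r lnt by (simp add: x_def powr_powr)
      also have "\<dots> \<le> real n powr (q - 1)"
        using n q by (intro powr_mono2) (auto simp: x_def)
      finally have "ln t \<le> r * real n powr (q - 1)"
        using r by (simp add: divide_le_eq mult.commute)
      then have "real n * ln t \<le> real n * (r * real n powr (q - 1))"
        by (intro mult_left_mono) auto
      also have "\<dots> = r * real n powr q"
        using powr_mult_base[of "real n" "q - 1"] by simp
      finally show ?thesis
        using lnt by (simp add: x_def add_increasing)
    qed
    then have "exp (real n * ln t) \<le> exp (x * ln t + r * real n powr q)"
      by simp
    also have "exp (real n * ln t) = t ^ n"
      using t by (simp add: exp_of_nat_mult)
    finally show ?thesis by (simp add: exp_add)
  qed
  then show ?thesis by (intro exI[of _ "exp (x * ln t)"]) auto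
qed

text \<open>The target R is given and r is found: R/t for flat indices, and R/2 for numbers s < 1/2,
  where the exponent 1/(2s) exceeds 1 and the spare half of R dominates t^|\<kappa>|. A lower index
  \<kappa>' is allowed because multiplication by the exponential draws on entries further down the
  diagonal.\<close>

lemma weight_absorb_below:
  assumes s: "s \<in> Rflat" "s < Num (1/2)" and R: "0 < R" and t: "1 \<le> t"
  shows "\<exists>r>0. \<exists>C\<ge>0. \<forall>\<kappa>' \<kappa> :: 'n::finite mindex. \<kappa>' \<le> \<kappa> \<longrightarrow>
    t ^ mabs \<kappa> * weight r s \<kappa>' \<le> C * weight R s \<kappa>"
proof (cases s)
  case (Flat \<sigma>)
  then have "0 < \<sigma>" using s by (auto simp: Rflat_def)
  then show ?thesis
    using weight_absorb_Flat[of \<sigma> "R / t" t] R t Flat by (intro exI[of _ "R / t"]) auto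
next
  case (Num x)
  then have x: "0 < x" "x < 1 / 2" using s by (auto simp: Rflat_def)
  define q where "q = 1 / (2 * x)"
  have q: "1 < q" using x by (simp add: q_def)
  obtain C where C: "C \<ge> 0" "\<And>n. t ^ n \<le> C * exp (R / 2 * real n powr q)"
    using power_le_exp_powr[OF q, of "R / 2" t] R t by auto
  have "t ^ mabs \<kappa> * weight (R / 2) s \<kappa>' \<le> C * weight R s \<kappa>"
    if le: "\<kappa>' \<le> \<kappa>" for \<kappa>' \<kappa> :: "'n mindex"
  proof -
    have "t ^ mabs \<kappa> * weight (R / 2) s \<kappa>' \<le> t ^ mabs \<kappa> * weight (R / 2) s \<kappa>"
      using R t q x mabs_mono[OF le] by (auto simp: Num q_def intro!: powr_mono2 divide_right_mono mult_left_mono)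
    also have "\<dots> \<le> (C * exp (R / 2 * real (mabs \<kappa>) powr q)) * weight (R / 2) s \<kappa>"
      using C(2) weight_pos[of "R / 2" s \<kappa>] R by (intro mult_right_mono) auto
    also have "\<dots> = C * weight R s \<kappa>"
      by (simp add: Num q_def mult.assoc exp_add[symmetric])
    finally show ?thesis .
  qed
  then show ?thesis using R C(1) by (intro exI[of _ "R / 2"]) auto
qed

text \<open>Here r is given and R is found: r t for flat indices, and r + ln t for numbers, since n
  \<le> n^q for natural n and q \<ge> 1. This includes s = 1/2, where q = 1.\<close>

lemma weight_absorb_above:
  assumes s: "s \<in> Rflat" "s \<le> Num (1/2)" and r: "0 < r" and t: "1 \<le> t"
  shows "\<exists>R>0. \<exists>C\<ge>0. \<forall>\<kappa>' \<kappa> :: 'n::finite mindex. \<kappa>' \<le> \<kappa> \<longrightarrow>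
    t ^ mabs \<kappa> * weight r s \<kappa>' \<le> C * weight R s \<kappa>"
proof (cases s)
  case (Flat \<sigma>)
  then have "0 < \<sigma>" using s by (auto simp: Rflat_def)
  then show ?thesis
    using weight_absorb_Flat[of \<sigma> r t] r t Flat by (intro exI[of _ "r * t"]) auto
next
  case (Num x)
  then have x: "0 < x" "x \<le> 1 / 2" using s by (auto simp: Rflat_def less_eq_rflat_def)
  define q where "q = 1 / (2 * x)"
  have q: "1 \<le> q" using x by (simp add: q_def)
  have lnt: "0 \<le> ln t" using t by simp
  have "t ^ mabs \<kappa> * weight r s \<kappa>' \<le> 1 * weight (r + ln t) s \<kappa>"
    if le: "\<kappa>' \<le> \<kappa>" for \<kappa>' \<kappa> :: "'n mindex"
  proof -
    let ?n = "real (mabs \<kappa>)"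
    have "?n \<le> ?n powr q"
    proof (cases "mabs \<kappa> = 0")
      case False
      then show ?thesis using powr_mono[of 1 q ?n] q by simp
    qed simp
    then have "?n * ln t \<le> ?n powr q * ln t"
      using lnt by (intro mult_right_mono)
    moreover have "real (mabs \<kappa>') powr q \<le> ?n powr q"
      using q mabs_mono[OF le] by (intro powr_mono2) auto
    then have "r * real (mabs \<kappa>') powr q \<le> r * ?n powr q"
      using r by simp
    ultimately have "exp (?n * ln t + r * real (mabs \<kappa>') powr q) \<le> exp ((r + ln t) * ?n powr q)"
      by (simp add: distrib_right mult.commute)
    moreover have "exp (?n * ln t) = t ^ mabs \<kappa>"
      using t by (simp add: exp_of_nat_mult)
    ultimately show ?thesis by (simp add: Num q_def exp_add)
  qed
  then show ?thesis using r lnt by (intro exI[of _ "r + ln t"] conjI exI[of _ "1::real"]) auto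
qed

section \<open>Multi-indices of length 2d as pairs\<close>

lemma mabs_Inl_Inr: "mabs \<kappa> = mabs (\<kappa> \<circ> Inl) + mabs (\<kappa> \<circ> Inr)"
  for \<kappa> :: "'a::finite + 'b::finite \<Rightarrow> nat"
  by (simp add: mabs_def UNIV_Plus_UNIV[symmetric] sum.Plus del: UNIV_Plus_UNIV)

lemma mfact_Inl_Inr: "mfact \<kappa> = mfact (\<kappa> \<circ> Inl) * mfact (\<kappa> \<circ> Inr)"
  for \<kappa> :: "'a::finite + 'b::finite \<Rightarrow> nat"
  by (simp add: mfact_def UNIV_Plus_UNIV[symmetric] prod.Plus del: UNIV_Plus_UNIV)

text \<open>For flat indices the weight is multiplicative over pairs. For numbers each of the two
  exponents is at most that of the whole index, and adding them doubles r.\<close>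

lemma weight_mult_le:
  fixes \<kappa> :: "'a::finite + 'b::finite \<Rightarrow> nat"
  assumes s: "s \<in> Rflat" and r: "0 < r"
  shows "weight r s (\<kappa> \<circ> Inl) * weight r s (\<kappa> \<circ> Inr) \<le> weight (2 * r) s \<kappa>"
proof (cases s)
  case (Num x)
  then have "0 < x" using s by (auto simp: Rflat_def)
  then have "real (mabs (\<kappa> \<circ> Inl)) powr (1 / (2 * x)) \<le> real (mabs \<kappa>) powr (1 / (2 * x))"
    "real (mabs (\<kappa> \<circ> Inr)) powr (1 / (2 * x)) \<le> real (mabs \<kappa>) powr (1 / (2 * x))"
    by (auto simp: mabs_Inl_Inr[of \<kappa>] intro!: powr_mono2)
  then have "r * real (mabs (\<kappa> \<circ> Inl)) powr (1 / (2 * x)) \<le> r * real (mabs \<kappa>) powr (1 / (2 * x))"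
    "r * real (mabs (\<kappa> \<circ> Inr)) powr (1 / (2 * x)) \<le> r * real (mabs \<kappa>) powr (1 / (2 * x))"
    using r by simp_all
  then show ?thesis by (simp add: Num exp_add[symmetric])
next
  case (Flat \<sigma>)
  have "weight r s (\<kappa> \<circ> Inl) * weight r s (\<kappa> \<circ> Inr) = weight r s \<kappa>"
    by (simp add: Flat mabs_Inl_Inr[of \<kappa>] mfact_Inl_Inr[of \<kappa>] power_add powr_mult)
  also have "\<dots> \<le> weight (2 * r) s \<kappa>"
    using r by (intro weight_mono) auto
  finally show ?thesis .
qed

section \<open>Geometric sums over multi-indices and comparison of l^p with weighted l^1\<close>

lemma mindex_interval_eq_PiE: "{\<gamma> :: 'n mindex. \<gamma> \<le> \<alpha>} = PiE UNIV (\<lambda>i. {..\<alpha> i})"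
  by (auto simp: le_fun_def PiE_def Pi_def extensional_def)

lemma finite_mindex_interval: "finite {\<gamma> :: 'n::finite mindex. \<gamma> \<le> \<alpha>}"
  unfolding mindex_interval_eq_PiE by (intro finite_PiE) auto

text \<open>A finite set of indices lies in a cube, over which the sum factors into one geometric
  sum per coordinate, each at most 2.\<close>

lemma summable_half_power_mabs: "(\<lambda>\<kappa> :: 'n::finite mindex. (1/2 :: real) ^ mabs \<kappa>) summable_on UNIV"
proof (rule nonneg_bdd_above_summable_on)
  have "(\<Sum>\<kappa>\<in>F. (1/2 :: real) ^ mabs \<kappa>) \<le> 2 ^ CARD('n)" if F: "finite F" for F :: "'n mindex set"
  proof -
    obtain N where N: "\<And>\<kappa> i. \<kappa> \<in> F \<Longrightarrow> \<kappa> i \<le> N"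
    proof
      fix \<kappa> i assume "\<kappa> \<in> F"
      then show "\<kappa> i \<le> (\<Sum>\<kappa>\<in>F. \<Sum>i\<in>UNIV. \<kappa> i)"
        using F member_le_sum[of \<kappa> F "\<lambda>\<kappa>. \<Sum>i\<in>UNIV. \<kappa> i"] member_le_sum[of i UNIV \<kappa>]
        by (meson UNIV_I finite le0 order_trans)
    qed
    have half: "(\<Sum>j\<le>N. (1/2 :: real) ^ j) \<le> 2"
      using sum_le_suminf[of "\<lambda>j. (1/2 :: real) ^ j" "{..N}"] suminf_geometric[of "1/2 :: real"]
      by (simp add: summable_geometric)
    have "(\<Sum>\<kappa>\<in>F. (1/2 :: real) ^ mabs \<kappa>) \<le> (\<Sum>\<kappa>\<in>PiE (UNIV :: 'n set) (\<lambda>i. {..N}). (1/2 :: real) ^ mabs \<kappa>)"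
      by (rule sum_mono2) (use N in \<open>auto intro!: finite_PiE\<close>)
    also have "\<dots> = (\<Prod>i\<in>(UNIV :: 'n set). \<Sum>j\<le>N. (1/2 :: real) ^ j)"
      by (subst prod_sum_PiE) (auto simp: power_mabs)
    also have "\<dots> \<le> (\<Prod>i\<in>(UNIV :: 'n set). 2)"
      using half by (intro prod_mono) (auto intro: sum_nonneg)
    finally show ?thesis by simp
  qed
  then show "bdd_above (sum (\<lambda>\<kappa> :: 'n mindex. (1/2 :: real) ^ mabs \<kappa>) ` {F. F \<subseteq> UNIV \<and> finite F})"
    by (auto simp: bdd_above_def)
qed simp

text \<open>The entries of c v are bounded by the l^p norm; the factor 2^|\<alpha>| to spare between
  the weights leaves a summable geometric majorant. This makes the exponent p irrelevant after a
  change of radius.\<close>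

lemma wsummable_if_in_lp:
  fixes c :: "'n::finite mseq"
  assumes p: "1 \<le> p" and c: "in_lp p (\<lambda>\<alpha>. c \<alpha> * of_real (v \<alpha>))"
    and v: "\<And>\<alpha>. 0 \<le> v \<alpha>" and w: "\<And>\<alpha>. 0 \<le> w \<alpha>" and le: "\<And>\<alpha>. 2 ^ mabs \<alpha> * w \<alpha> \<le> C * v \<alpha>"
    and C: "0 \<le> C"
  shows "wsummable w c"
  unfolding wsummable_def
proof (rule summable_on_comparison_test)
  let ?N = "lp_norm p (\<lambda>\<alpha>. c \<alpha> * of_real (v \<alpha>))"
  show "(\<lambda>\<alpha> :: 'n mindex. (?N * C) * (1/2) ^ mabs \<alpha>) summable_on UNIV"
    by (intro summable_on_cmult_right summable_half_power_mabs)
  fix \<alpha>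
  have "norm (c \<alpha>) * v \<alpha> \<le> ?N"
    using norm_le_lp_norm[OF p c, of \<alpha>] v[of \<alpha>] by (simp add: norm_mult)
  have "norm (c \<alpha>) * (2 ^ mabs \<alpha> * w \<alpha>) \<le> norm (c \<alpha>) * (C * v \<alpha>)"
    using le by (intro mult_left_mono) auto
  also have "\<dots> = norm (c \<alpha>) * v \<alpha> * C" by simp
  also have "\<dots> \<le> ?N * C"
    using C \<open>norm (c \<alpha>) * v \<alpha> \<le> ?N\<close> by (intro mult_right_mono)
  finally show "norm (c \<alpha>) * w \<alpha> \<le> (?N * C) * (1/2) ^ mabs \<alpha>"
    by (simp add: power_divide field_simps)
qed (use w in auto)

lemma in_lp_if_norm_le:
  fixes c :: "'n::finite mseq"
  assumes p: "1 \<le> p" and v: "\<And>\<alpha>. 0 < v \<alpha>" and le: "\<And>\<alpha>. 2 ^ mabs \<alpha> * norm (c \<alpha>) \<le> C * v \<alpha>"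
  shows "in_lp p (\<lambda>\<alpha>. c \<alpha> * of_real (1 / v \<alpha>))"
proof (rule summable_imp_in_lp(1)[OF p], rule summable_on_comparison_test)
  show "(\<lambda>\<alpha> :: 'n mindex. C * (1/2) ^ mabs \<alpha>) summable_on UNIV"
    by (intro summable_on_cmult_right summable_half_power_mabs)
  show "norm (c \<alpha> * of_real (1 / v \<alpha>)) \<le> C * (1/2) ^ mabs \<alpha>" for \<alpha>
    using le[of \<alpha>] v[of \<alpha>] by (simp add: norm_divide power_divide field_simps)
qed simp

subsection \<open>Multiplication by \<open>e\<^bsup>(z,w)\<^esup>\<close> and its inverse\<close>

text \<open>In the coefficients of the monomials, multiplication by \<open>e\<^bsup>t(z,w)\<^esup>\<close> is convolution with
  \<open>t\<^bsup>|\<gamma>|\<^esup>/\<gamma>!\<close> along the diagonal; \<open>mult_exp\<close> is the case \<open>t = 1\<close>, inverted by \<open>t = -1\<close>.\<close>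

definition diag_conv_exp :: "complex \<Rightarrow> 'd::finite fseries2 \<Rightarrow> 'd fseries2" where
  "diag_conv_exp t a = (\<lambda>\<alpha> \<beta>. \<Sum>\<gamma> | \<gamma> \<le> \<alpha> \<and> \<gamma> \<le> \<beta>. t ^ mabs \<gamma> / of_real (mfact \<gamma>) * a (\<alpha> - \<gamma>) (\<beta> - \<gamma>))"

lemma finite_mindex_interval2: "finite {\<gamma> :: 'n::finite mindex. \<gamma> \<le> \<alpha> \<and> \<gamma> \<le> \<beta>}"
  by (rule finite_subset[OF _ finite_mindex_interval[of \<alpha>]]) auto

lemma mbinom_eq:
  assumes "\<gamma> \<le> \<alpha>"
  shows "mbinom \<alpha> \<gamma> = mfact \<alpha> / (mfact \<gamma> * mfact (\<alpha> - \<gamma>))"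
proof -
  have "mbinom \<alpha> \<gamma> = (\<Prod>i\<in>UNIV. fact (\<alpha> i) / (fact (\<gamma> i) * fact (\<alpha> i - \<gamma> i)))"
    unfolding mbinom_def using assms by (intro prod.cong) (auto simp: binomial_fact le_fun_def)
  then show ?thesis by (simp add: mfact_def prod_dividef prod.distrib)
qed

text \<open>The square roots of binomials in the basis e_\<alpha> are what the normalisation makes
  of the factor 1/\<gamma>! in the basis of monomials.\<close>

lemma sqrt_mfact_mbinom:
  assumes "\<gamma> \<le> \<alpha>" "\<gamma> \<le> \<beta>"
  shows "sqrt (mfact (\<alpha> - \<gamma>)) * sqrt (mfact (\<beta> - \<gamma>)) * sqrt (mbinom \<alpha> \<gamma> * mbinom \<beta> \<gamma>)
    = sqrt (mfact \<alpha>) * sqrt (mfact \<beta>) / mfact \<gamma>"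
proof -
  have "mfact (\<alpha> - \<gamma>) * mfact (\<beta> - \<gamma>) * (mbinom \<alpha> \<gamma> * mbinom \<beta> \<gamma>)
      = mfact \<alpha> * mfact \<beta> / (mfact \<gamma>)\<^sup>2"
    using mfact_pos[of "\<alpha> - \<gamma>"] mfact_pos[of "\<beta> - \<gamma>"]
    by (simp add: mbinom_eq assms power2_eq_square field_simps)
  then have "sqrt (mfact (\<alpha> - \<gamma>) * mfact (\<beta> - \<gamma>) * (mbinom \<alpha> \<gamma> * mbinom \<beta> \<gamma>))
      = sqrt (mfact \<alpha> * mfact \<beta> / (mfact \<gamma>)\<^sup>2)"
    by simp
  then show ?thesis
    using mfact_pos[of \<gamma>] by (simp add: real_sqrt_mult real_sqrt_divide)
qed

lemma coeff_e2_diag_conv_exp: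
  "coeff_e2 (diag_conv_exp t a) \<alpha> \<beta> = (\<Sum>\<gamma> | \<gamma> \<le> \<alpha> \<and> \<gamma> \<le> \<beta>.
    t ^ mabs \<gamma> * (coeff_e2 a (\<alpha> - \<gamma>) (\<beta> - \<gamma>) * of_real (sqrt (mbinom \<alpha> \<gamma> * mbinom \<beta> \<gamma>))))"
  unfolding coeff_e2_def diag_conv_exp_def sum_distrib_left
proof (rule sum.cong[OF refl])
  fix \<gamma> assume "\<gamma> \<in> {\<gamma>. \<gamma> \<le> \<alpha> \<and> \<gamma> \<le> \<beta>}"
  then have g: "\<gamma> \<le> \<alpha>" "\<gamma> \<le> \<beta>" by auto
  have "complex_of_real (sqrt (mfact \<alpha>) * sqrt (mfact \<beta>)) / of_real (mfact \<gamma>)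
      = of_real (sqrt (mfact (\<alpha> - \<gamma>)) * sqrt (mfact (\<beta> - \<gamma>))) * of_real (sqrt (mbinom \<alpha> \<gamma> * mbinom \<beta> \<gamma>))"
    by (simp only: sqrt_mfact_mbinom[OF g] of_real_mult[symmetric] of_real_divide[symmetric])
  then have "t ^ mabs \<gamma> * a (\<alpha> - \<gamma>) (\<beta> - \<gamma>) * (complex_of_real (sqrt (mfact \<alpha>) * sqrt (mfact \<beta>)) / of_real (mfact \<gamma>))
      = t ^ mabs \<gamma> * a (\<alpha> - \<gamma>) (\<beta> - \<gamma>) * (of_real (sqrt (mfact (\<alpha> - \<gamma>)) * sqrt (mfact (\<beta> - \<gamma>))) * of_real (sqrt (mbinom \<alpha> \<gamma> * mbinom \<beta> \<gamma>)))"
    by (simp only:)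
  then show "complex_of_real (sqrt (mfact \<alpha>) * sqrt (mfact \<beta>)) * (t ^ mabs \<gamma> / of_real (mfact \<gamma>) * a (\<alpha> - \<gamma>) (\<beta> - \<gamma>))
      = t ^ mabs \<gamma> * (of_real (sqrt (mfact (\<alpha> - \<gamma>)) * sqrt (mfact (\<beta> - \<gamma>))) * a (\<alpha> - \<gamma>) (\<beta> - \<gamma>) * of_real (sqrt (mbinom \<alpha> \<gamma> * mbinom \<beta> \<gamma>)))"
    by (simp add: mult_ac)
qed

lemma mult_exp_eq: "mult_exp a = diag_conv_exp 1 a"
proof -
  have "coeff_e2 (mult_exp a) = coeff_e2 (diag_conv_exp 1 a)"
    by (intro ext) (simp add: coeff_e2_diag_conv_exp, simp add: mult_exp_def)
  then have "series_e2 (coeff_e2 (mult_exp a)) = series_e2 (coeff_e2 (diag_conv_exp 1 a))"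
    by simp
  then show ?thesis by simp
qed

section \<open>The group law for multiplication by exponentials\<close>

lemma sum_exp_coeffs_1:
  "(\<Sum>j\<le>n. s ^ j / fact j * (t ^ (n - j) / fact (n - j))) = (s + t) ^ n / fact n" for s t :: complex
proof -
  have "(s + t) ^ n / fact n = (\<Sum>j\<le>n. of_nat (n choose j) * s ^ j * t ^ (n - j)) / fact n"
    by (simp add: binomial_ring)
  also have "\<dots> = (\<Sum>j\<le>n. s ^ j / fact j * (t ^ (n - j) / fact (n - j)))"
    unfolding sum_divide_distrib by (intro sum.cong) (auto simp: binomial_fact field_simps)
  finally show ?thesis ..
qed

text \<open>The binomial theorem for multi-indices: the sum over the box below \<epsilon> factors
  into the one-dimensional sums.\<close>

lemma sum_exp_coeffs:
  fixes \<epsilon> :: "'n::finite mindex" and s t :: complex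
  shows "(\<Sum>\<gamma> | \<gamma> \<le> \<epsilon>. s ^ mabs \<gamma> / of_real (mfact \<gamma>) * (t ^ mabs (\<epsilon> - \<gamma>) / of_real (mfact (\<epsilon> - \<gamma>))))
    = (s + t) ^ mabs \<epsilon> / of_real (mfact \<epsilon>)"
proof -
  have frac: "x ^ mabs \<gamma> / of_real (mfact \<gamma>) = (\<Prod>i\<in>UNIV. x ^ \<gamma> i / fact (\<gamma> i))" for x :: complex and \<gamma> :: "'n mindex"
    by (simp add: prod_dividef power_mabs mfact_def)
  have "(\<Sum>\<gamma> | \<gamma> \<le> \<epsilon>. s ^ mabs \<gamma> / of_real (mfact \<gamma>) * (t ^ mabs (\<epsilon> - \<gamma>) / of_real (mfact (\<epsilon> - \<gamma>))))
      = (\<Sum>\<gamma>\<in>PiE UNIV (\<lambda>i. {..\<epsilon> i}). \<Prod>i\<in>UNIV. s ^ \<gamma> i / fact (\<gamma> i) * (t ^ (\<epsilon> i - \<gamma> i) / fact (\<epsilon> i - \<gamma> i)))"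
    unfolding mindex_interval_eq_PiE by (simp add: frac prod.distrib[symmetric])
  also have "\<dots> = (\<Prod>i\<in>UNIV. \<Sum>j\<le>\<epsilon> i. s ^ j / fact j * (t ^ (\<epsilon> i - j) / fact (\<epsilon> i - j)))"
    by (subst prod_sum_PiE) auto
  also have "\<dots> = (s + t) ^ mabs \<epsilon> / of_real (mfact \<epsilon>)"
    by (simp only: sum_exp_coeffs_1 frac)
  finally show ?thesis .
qed

text \<open>The identity e^(s(z,w)) e^(t(z,w)) = e^((s+t)(z,w)) on formal series; it makes t = -1 a
  two-sided inverse of t = 1.\<close>

lemma diag_conv_exp_compose: "diag_conv_exp s (diag_conv_exp t a) = diag_conv_exp (s + t) a"
proof (intro ext)
  fix \<alpha> \<beta> :: "'a mindex"
  define I where "I = {\<gamma>. \<gamma> \<le> \<alpha> \<and> \<gamma> \<le> \<beta>}"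
  define c where "c = (\<lambda>(x :: complex) (\<gamma> :: 'a mindex). x ^ mabs \<gamma> / of_real (mfact \<gamma>))"
  have fin: "finite I" unfolding I_def by (rule finite_mindex_interval2)
  have "diag_conv_exp s (diag_conv_exp t a) \<alpha> \<beta>
      = (\<Sum>\<gamma>\<in>I. \<Sum>\<delta> | \<delta> \<le> \<alpha> - \<gamma> \<and> \<delta> \<le> \<beta> - \<gamma>. c s \<gamma> * (c t \<delta> * a (\<alpha> - \<gamma> - \<delta>) (\<beta> - \<gamma> - \<delta>)))"
    by (simp add: diag_conv_exp_def sum_distrib_left c_def I_def)
  also have "\<dots> = (\<Sum>(\<gamma>,\<delta>)\<in>(SIGMA \<gamma>:I. {\<delta>. \<delta> \<le> \<alpha> - \<gamma> \<and> \<delta> \<le> \<beta> - \<gamma>}).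
      c s \<gamma> * (c t \<delta> * a (\<alpha> - \<gamma> - \<delta>) (\<beta> - \<gamma> - \<delta>)))"
    using fin by (intro sum.Sigma) (auto intro: finite_mindex_interval2)
  also have "\<dots> = (\<Sum>(\<epsilon>,\<gamma>)\<in>(SIGMA \<epsilon>:I. {\<gamma>. \<gamma> \<le> \<epsilon>}). c s \<gamma> * c t (\<epsilon> - \<gamma>) * a (\<alpha> - \<epsilon>) (\<beta> - \<epsilon>))"
  \<comment> \<open>Substitution of the total shift \<epsilon> = \<gamma> + \<delta> for \<delta>,
    so that the inner sum becomes a binomial sum over \<gamma> \<le> \<epsilon>.\<close>
  proof (rule sum.reindex_bij_witness[where j = "\<lambda>(\<gamma>,\<delta>). (\<gamma> + \<delta>, \<gamma>)" and i = "\<lambda>(\<epsilon>,\<gamma>). (\<gamma>, \<epsilon> - \<gamma>)"])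
    fix x assume "x \<in> (SIGMA \<gamma>:I. {\<delta>. \<delta> \<le> \<alpha> - \<gamma> \<and> \<delta> \<le> \<beta> - \<gamma>})"
    then obtain \<gamma> \<delta> where x: "x = (\<gamma>, \<delta>)" "\<gamma> \<le> \<alpha>" "\<gamma> \<le> \<beta>" "\<delta> \<le> \<alpha> - \<gamma>" "\<delta> \<le> \<beta> - \<gamma>"
      by (auto simp: I_def)
    show "(case case x of (\<gamma>, \<delta>) \<Rightarrow> (\<gamma> + \<delta>, \<gamma>) of (\<epsilon>, \<gamma>) \<Rightarrow> (\<gamma>, \<epsilon> - \<gamma>)) = x"
      by (auto simp: x fun_eq_iff)
    have "\<gamma> i + \<delta> i \<le> \<alpha> i" "\<gamma> i + \<delta> i \<le> \<beta> i" for i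
      using x(2-5)[THEN le_funD, of i] by auto
    then show "(case x of (\<gamma>, \<delta>) \<Rightarrow> (\<gamma> + \<delta>, \<gamma>)) \<in> (SIGMA \<epsilon>:I. {\<gamma>. \<gamma> \<le> \<epsilon>})"
      by (auto simp: x(1) I_def le_fun_def)
    have "\<alpha> - \<gamma> - \<delta> = \<alpha> - (\<gamma> + \<delta>)" "\<beta> - \<gamma> - \<delta> = \<beta> - (\<gamma> + \<delta>)" "\<gamma> + \<delta> - \<gamma> = \<delta>"
      by (auto simp: fun_eq_iff)
    then show "(case case x of (\<gamma>, \<delta>) \<Rightarrow> (\<gamma> + \<delta>, \<gamma>) of (\<epsilon>, \<gamma>) \<Rightarrow> c s \<gamma> * c t (\<epsilon> - \<gamma>) * a (\<alpha> - \<epsilon>) (\<beta> - \<epsilon>))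
        = (case x of (\<gamma>, \<delta>) \<Rightarrow> c s \<gamma> * (c t \<delta> * a (\<alpha> - \<gamma> - \<delta>) (\<beta> - \<gamma> - \<delta>)))"
      by (simp only: x(1) prod.case mult.assoc)
  next
    fix y assume "y \<in> (SIGMA \<epsilon>:I. {\<gamma>. \<gamma> \<le> \<epsilon>})"
    then obtain \<epsilon> \<gamma> where y: "y = (\<epsilon>, \<gamma>)" "\<epsilon> \<le> \<alpha>" "\<epsilon> \<le> \<beta>" "\<gamma> \<le> \<epsilon>"
      by (auto simp: I_def)
    show "(case case y of (\<epsilon>, \<gamma>) \<Rightarrow> (\<gamma>, \<epsilon> - \<gamma>) of (\<gamma>, \<delta>) \<Rightarrow> (\<gamma> + \<delta>, \<gamma>)) = y"
      using y(4) by (auto simp: y(1) fun_eq_iff le_fun_def)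
    show "(case y of (\<epsilon>, \<gamma>) \<Rightarrow> (\<gamma>, \<epsilon> - \<gamma>)) \<in> (SIGMA \<gamma>:I. {\<delta>. \<delta> \<le> \<alpha> - \<gamma> \<and> \<delta> \<le> \<beta> - \<gamma>})"
      using y(2-4) by (auto simp: y(1) I_def le_fun_def intro: order_trans diff_le_mono)
  qed
  also have "\<dots> = (\<Sum>\<epsilon>\<in>I. \<Sum>\<gamma> | \<gamma> \<le> \<epsilon>. c s \<gamma> * c t (\<epsilon> - \<gamma>) * a (\<alpha> - \<epsilon>) (\<beta> - \<epsilon>))"
    using fin by (intro sum.Sigma[symmetric]) (auto intro: finite_mindex_interval)
  also have "\<dots> = (\<Sum>\<epsilon>\<in>I. c (s + t) \<epsilon> * a (\<alpha> - \<epsilon>) (\<beta> - \<epsilon>))"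
    unfolding sum_distrib_right[symmetric] c_def sum_exp_coeffs ..
  finally show "diag_conv_exp s (diag_conv_exp t a) \<alpha> \<beta> = diag_conv_exp (s + t) a \<alpha> \<beta>"
    by (simp add: diag_conv_exp_def c_def I_def)
qed

lemma mabs_eq_0_iff: "mabs \<gamma> = 0 \<longleftrightarrow> \<gamma> = 0"
  by (auto simp: mabs_def fun_eq_iff)

lemma diag_conv_exp_0: "diag_conv_exp 0 a = a"
proof (intro ext)
  fix \<alpha> \<beta> :: "'a mindex"
  \<comment> \<open>Only \<gamma> = 0 survives, through the convention 0 ^ 0 = 1.\<close>
  have "diag_conv_exp 0 a \<alpha> \<beta> = (\<Sum>\<gamma> | \<gamma> \<le> \<alpha> \<and> \<gamma> \<le> \<beta>. if \<gamma> = 0 then a \<alpha> \<beta> else 0)"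
    unfolding diag_conv_exp_def
    by (intro sum.cong refl) (auto simp: mabs_eq_0_iff power_0_left mfact_def)
  also have "\<dots> = a \<alpha> \<beta>"
    by (subst sum.delta[OF finite_mindex_interval2]) (auto simp: le_fun_def)
  finally show "diag_conv_exp 0 a \<alpha> \<beta> = a \<alpha> \<beta>" .
qed

lemma mult_exp_diag_conv_exp [simp]: "mult_exp (diag_conv_exp (- 1) a) = a"
  and diag_conv_exp_mult_exp [simp]: "diag_conv_exp (- 1) (mult_exp a) = a"
  by (simp_all add: mult_exp_eq diag_conv_exp_compose diag_conv_exp_0)

section \<open>Growth of the inverse multiplication\<close>

lemma mbinom_le_power: "mbinom \<alpha> \<gamma> \<le> 2 ^ mabs \<alpha>"
proof -
  have "mbinom \<alpha> \<gamma> \<le> (\<Prod>i\<in>UNIV. 2 ^ \<alpha> i)"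
    unfolding mbinom_def
  proof (rule prod_mono, safe)
    fix i
    have "real (\<alpha> i choose \<gamma> i) \<le> real (2 ^ \<alpha> i)"
      using binomial_le_pow2 by (simp only: of_nat_le_iff)
    then show "real (\<alpha> i choose \<gamma> i) \<le> 2 ^ \<alpha> i" by simp
  qed simp
  then show ?thesis by (simp add: power_mabs)
qed

lemma mbinom_nonneg: "0 \<le> mbinom \<alpha> \<gamma>"
  unfolding mbinom_def by (intro prod_nonneg) auto

lemma card_mindex_interval_le: "card {\<gamma> :: 'n::finite mindex. \<gamma> \<le> \<alpha>} \<le> 2 ^ mabs \<alpha>"
proof -
  have "card {\<gamma>. \<gamma> \<le> \<alpha>} = (\<Prod>i\<in>UNIV. Suc (\<alpha> i))"
    unfolding mindex_interval_eq_PiE by (simp add: card_PiE)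
  also have "\<dots> \<le> (\<Prod>i\<in>UNIV. 2 ^ \<alpha> i)"
    by (intro prod_mono) (auto simp: Suc_le_eq)
  finally show ?thesis by (simp add: power_mabs)
qed

text \<open>With n = |\<alpha>| + |\<beta>| there are at most 2^n terms, and each root of binomials
  is at most 2^n; together they give 4^n.\<close>

lemma norm_diag_conv_exp_le:
  fixes k :: "'d::finite fseries2"
  assumes k: "\<And>\<gamma>. \<gamma> \<le> \<alpha> \<Longrightarrow> \<gamma> \<le> \<beta> \<Longrightarrow> norm (coeff_e2 k (\<alpha> - \<gamma>) (\<beta> - \<gamma>)) \<le> M"
  shows "norm (coeff_e2 (diag_conv_exp (- 1) k) \<alpha> \<beta>) \<le> 4 ^ (mabs \<alpha> + mabs \<beta>) * M"
proof -
  let ?I = "{\<gamma>. \<gamma> \<le> \<alpha> \<and> \<gamma> \<le> \<beta>}" and ?n = "mabs \<alpha> + mabs \<beta>"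
  \<comment> \<open>The term \<gamma> = 0 shows that M is nonnegative.\<close>
  have "norm (coeff_e2 k (\<alpha> - 0) (\<beta> - 0)) \<le> M"
    by (rule k) (auto simp: le_fun_def)
  then have "0 \<le> M"
    by (rule order_trans[OF norm_ge_zero])
  have sq: "sqrt (mbinom \<alpha> \<gamma> * mbinom \<beta> \<gamma>) \<le> 2 ^ ?n" for \<gamma>
  proof -
    have "mbinom \<alpha> \<gamma> * mbinom \<beta> \<gamma> \<le> 2 ^ mabs \<alpha> * 2 ^ mabs \<beta>"
      by (intro mult_mono mbinom_le_power mbinom_nonneg) auto
    also have "\<dots> = 2 ^ ?n" by (simp add: power_add)
    also have "(2::real) ^ ?n \<le> (2 ^ ?n)\<^sup>2"
      by (simp add: power2_eq_square)
    finally show ?thesis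
      by (intro real_le_lsqrt) (auto simp: mbinom_nonneg)
  qed
  have "norm (coeff_e2 (diag_conv_exp (- 1) k) \<alpha> \<beta>)
      \<le> (\<Sum>\<gamma>\<in>?I. norm ((- 1) ^ mabs \<gamma> * (coeff_e2 k (\<alpha> - \<gamma>) (\<beta> - \<gamma>)
          * complex_of_real (sqrt (mbinom \<alpha> \<gamma> * mbinom \<beta> \<gamma>)))))"
    unfolding coeff_e2_diag_conv_exp by (rule norm_sum)
  also have "\<dots> \<le> (\<Sum>\<gamma>\<in>?I. M * 2 ^ ?n)"
    using k sq \<open>0 \<le> M\<close> by (intro sum_mono) (auto simp: norm_mult norm_power mbinom_nonneg simp del: real_sqrt_mult intro!: mult_mono)
  also have "\<dots> = real (card ?I) * (M * 2 ^ ?n)" by simp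
  also have "\<dots> \<le> 2 ^ ?n * (M * 2 ^ ?n)"
  proof (rule mult_right_mono)
    have "card ?I \<le> card {\<gamma>. \<gamma> \<le> \<alpha>}"
      by (intro card_mono finite_mindex_interval) auto
    also have "\<dots> \<le> 2 ^ mabs \<alpha>" by (rule card_mindex_interval_le)
    also have "\<dots> \<le> 2 ^ ?n" by (simp add: power_increasing)
    finally have "real (card ?I) \<le> real (2 ^ ?n)" by (simp only: of_nat_le_iff)
    then show "real (card ?I) \<le> 2 ^ ?n" by simp
  qed (use \<open>0 \<le> M\<close> in simp)
  also have "\<dots> = 4 ^ ?n * M"
    by (simp add: mult.commute mult.left_commute power_mult_distrib[symmetric])
  finally show ?thesis .
qed

subsection \<open>Kernels of continuous linear maps\<close>

definition unit_seq :: "'n mindex \<Rightarrow> 'n mseq" where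
  "unit_seq \<beta> = (\<lambda>\<alpha>. if \<alpha> = \<beta> then 1 else 0)"

text \<open>The algebraic part of the kernel representation: on a finite truncation of any sequence,
  S acts as the matrix whose columns are the images of the unit sequences.\<close>

lemma clinear_on_restrict:
  fixes S :: "'n::finite mseq \<Rightarrow> 'n mseq"
  assumes lin: "clinear_on E S" and unit: "\<And>\<beta>. unit_seq \<beta> \<in> E"
    and add: "\<And>c d. c \<in> E \<Longrightarrow> d \<in> E \<Longrightarrow> c + d \<in> E"
    and scale: "\<And>c k. c \<in> E \<Longrightarrow> (\<lambda>\<alpha>. k * c \<alpha>) \<in> E"
    and fin: "finite A"
  shows "(\<lambda>\<alpha>. if \<alpha> \<in> A then c \<alpha> else 0) \<in> E \<and>
    S (\<lambda>\<alpha>. if \<alpha> \<in> A then c \<alpha> else 0) = (\<lambda>\<alpha>. \<Sum>\<beta>\<in>A. S (unit_seq \<beta>) \<alpha> * c \<beta>)"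
  using fin
proof induction
  case empty
  have "(\<lambda>\<alpha>. 0 * unit_seq undefined \<alpha>) \<in> E" by (intro scale unit)
  moreover have "S 0 = 0" by (rule clinear_on_zero[OF lin unit])
  ultimately show ?case by (simp add: zero_fun_def)
next
  case (insert \<beta> A)
  let ?d = "\<lambda>\<alpha>. if \<alpha> \<in> A then c \<alpha> else 0" and ?e = "\<lambda>\<alpha>. c \<beta> * unit_seq \<beta> \<alpha>"
  have eq: "(\<lambda>\<alpha>. if \<alpha> \<in> insert \<beta> A then c \<alpha> else 0) = ?d + ?e"
    using insert.hyps by (intro ext) (auto simp: unit_seq_def)
  have d: "?d \<in> E" and e: "?e \<in> E" using insert.IH scale[OF unit] by auto
  have "S (?d + ?e) = S ?d + S ?e"
    using lin d e unfolding clinear_on_def by blast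
  also have "S ?e = (\<lambda>\<alpha>. c \<beta> * S (unit_seq \<beta>) \<alpha>)"
    by (rule clinear_on_scale[OF lin unit])
  also have "S ?d = (\<lambda>\<alpha>. \<Sum>\<beta>\<in>A. S (unit_seq \<beta>) \<alpha> * c \<beta>)"
    using insert.IH by blast
  also have "\<dots> + (\<lambda>\<alpha>. c \<beta> * S (unit_seq \<beta>) \<alpha>) = (\<lambda>\<alpha>. \<Sum>\<beta>\<in>insert \<beta> A. S (unit_seq \<beta>) \<alpha> * c \<beta>)"
    using insert.hyps by (simp add: fun_eq_iff add.commute mult.commute)
  finally show ?case unfolding eq using add[OF d e] by blast
qed

text \<open>The difference between S c and a partial sum over A is S applied to the part of c
  outside A. The bound estimates it by C times the tail of a convergent weighted sum, which tends to
  0.\<close>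

lemma clinear_on_has_sum:
  fixes S :: "'n::finite mseq \<Rightarrow> 'n mseq"
  assumes lin: "clinear_on E S" and unit: "\<And>\<beta>. unit_seq \<beta> \<in> E"
    and add: "\<And>c d. c \<in> E \<Longrightarrow> d \<in> E \<Longrightarrow> c + d \<in> E"
    and scale: "\<And>c k. c \<in> E \<Longrightarrow> (\<lambda>\<alpha>. k * c \<alpha>) \<in> E"
    and bound: "\<And>c. c \<in> E \<Longrightarrow> norm (S c \<alpha>) \<le> C * wsum w c"
    and c: "c \<in> E" "wsummable w c"
  shows "((\<lambda>\<beta>. S (unit_seq \<beta>) \<alpha> * c \<beta>) has_sum S c \<alpha>) UNIV"
proof -
  let ?f = "\<lambda>\<beta>. S (unit_seq \<beta>) \<alpha> * c \<beta>" and ?n = "\<lambda>\<beta>. norm (c \<beta>) * w \<beta>"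
  have rest: "norm (S c \<alpha> - sum ?f A) \<le> C * (wsum w c - sum ?n A)" if A: "finite A" for A
  proof -
    define d where "d = (\<lambda>\<alpha>. if \<alpha> \<in> A then c \<alpha> else 0)"
    define e where "e = (\<lambda>\<alpha>. if \<alpha> \<in> A then 0 else c \<alpha>)"
    have d: "d \<in> E" "S d = (\<lambda>\<alpha>. \<Sum>\<beta>\<in>A. S (unit_seq \<beta>) \<alpha> * c \<beta>)"
      using clinear_on_restrict[OF lin unit add scale A, of c] by (auto simp: d_def)
    \<comment> \<open>The tail is written as a sum and a multiple, under which E is assumed to be
      closed.\<close>
    have "e = c + (\<lambda>\<alpha>. (-1) * d \<alpha>)"
      by (auto simp: e_def d_def fun_eq_iff)
    then have e: "e \<in> E"
      using add[OF c(1) scale[OF d(1), of "-1"]] by simp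
    have "c = d + e" by (auto simp: e_def d_def fun_eq_iff)
    then have "S c = S d + S e"
      using lin d(1) e unfolding clinear_on_def by blast
    then have "S c \<alpha> - sum ?f A = S e \<alpha>"
      by (simp add: d(2))
    moreover have "wsum w e = wsum w c - sum ?n A"
    proof -
      have "infsum ?n UNIV = infsum ?n A + infsum ?n (- A)"
        using c(2) A infsum_Un_disjoint[of ?n A "- A"] summable_on_subset_banach[of ?n UNIV "- A"]
        by (simp add: wsummable_def)
      moreover have "wsum w e = infsum ?n (- A)"
        unfolding wsum_def by (rule infsum_cong_neutral) (auto simp: e_def)
      ultimately show ?thesis using A by (simp add: wsum_def)
    qed
    ultimately show ?thesis using bound[OF e] by simp
  qed
  have "((\<lambda>A. sum ?n A) \<longlongrightarrow> wsum w c) (finite_subsets_at_top UNIV)"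
    using c(2) has_sum_infsum[of ?n UNIV] unfolding wsum_def wsummable_def has_sum_def by simp
  then have "((\<lambda>A. C * (wsum w c - sum ?n A)) \<longlongrightarrow> C * (wsum w c - wsum w c)) (finite_subsets_at_top UNIV)"
    by (intro tendsto_intros)
  then have "((\<lambda>A. C * (wsum w c - sum ?n A)) \<longlongrightarrow> 0) (finite_subsets_at_top UNIV)"
    by simp
  then have "((\<lambda>A. S c \<alpha> - sum ?f A) \<longlongrightarrow> 0) (finite_subsets_at_top UNIV)"
    by (rule Lim_null_comparison[rotated]) (intro eventually_finite_subsets_at_top_weakI rest)
  then have "((\<lambda>A. S c \<alpha> - (S c \<alpha> - sum ?f A)) \<longlongrightarrow> S c \<alpha> - 0) (finite_subsets_at_top UNIV)"
    by (intro tendsto_intros)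
  then show ?thesis unfolding has_sum_def by simp
qed

lemma wsum_unit_seq: "wsum w (unit_seq \<beta>) = w \<beta>" and wsummable_unit_seq: "wsummable w (unit_seq \<beta>)"
proof -
  have "((\<lambda>\<alpha>. norm (unit_seq \<beta> \<alpha>) * w \<alpha>) has_sum (\<Sum>\<alpha>\<in>{\<beta>}. norm (unit_seq \<beta> \<alpha>) * w \<alpha>)) UNIV"
    by (rule has_sum_finite_neutralI[of "{\<beta>}"]) (auto simp: unit_seq_def)
  then have "((\<lambda>\<alpha>. norm (unit_seq \<beta> \<alpha>) * w \<alpha>) has_sum w \<beta>) UNIV"
    by (simp add: unit_seq_def)
  then show "wsum w (unit_seq \<beta>) = w \<beta>" "wsummable w (unit_seq \<beta>)"
    unfolding wsum_def wsummable_def by (auto intro: infsumI has_sum_imp_summable)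
qed

lemma wsummable_add:
  assumes w: "\<And>\<alpha>. 0 \<le> w \<alpha>" and "wsummable w c" "wsummable w d"
  shows "wsummable w (c + d)"
  unfolding wsummable_def
proof (rule summable_on_comparison_test)
  show "(\<lambda>\<alpha>. norm (c \<alpha>) * w \<alpha> + norm (d \<alpha>) * w \<alpha>) summable_on UNIV"
    using assms(2,3) unfolding wsummable_def by (rule summable_on_add)
  show "norm ((c + d) \<alpha>) * w \<alpha> \<le> norm (c \<alpha>) * w \<alpha> + norm (d \<alpha>) * w \<alpha>" for \<alpha>
    using mult_right_mono[OF norm_triangle_ineq[of "c \<alpha>" "d \<alpha>"] w[of \<alpha>]] by (simp add: distrib_right)
qed (use w in auto)

text \<open>A test sequence \<open>u\<close> is admissible if \<open>c \<mapsto> sup |c\<^sub>\<alpha>| u\<^sub>\<alpha>\<close> is a continuous seminorm on the inductive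
  limit. If the bound failed for every \<open>r\<close> and \<open>C\<close>, one admissible sequence would detect
  infinitely many violations at once.\<close>

lemma kernel_bound_if_tested:
  fixes w :: "real \<Rightarrow> 'a \<Rightarrow> real" and k :: "'a \<Rightarrow> 'a \<Rightarrow> real"
  assumes w: "\<And>r \<alpha>. 0 < r \<Longrightarrow> 0 < w r \<alpha>"
    and mono: "\<And>r r' \<alpha>. 0 < r \<Longrightarrow> r \<le> r' \<Longrightarrow> w r \<alpha> \<le> w r' \<alpha>"
    and k: "\<And>\<alpha> \<beta>. 0 \<le> k \<alpha> \<beta>"
    and test: "\<And>u. (\<And>\<alpha>. 0 \<le> u \<alpha>) \<Longrightarrow> (\<And>R. 0 < R \<Longrightarrow> \<exists>M. \<forall>\<alpha>. u \<alpha> * w R \<alpha> \<le> M) \<Longrightarrow>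
      \<exists>r>0. \<exists>C\<ge>0. \<forall>\<alpha> \<beta>. k \<alpha> \<beta> * u \<alpha> \<le> C * w r \<beta>"
  shows "\<exists>r>0. \<exists>C\<ge>0. \<forall>\<alpha> \<beta>. k \<alpha> \<beta> \<le> C * (w r \<alpha> * w r \<beta>)"
proof (rule ccontr)
  assume contra: "\<not> ?thesis"
  \<comment> \<open>Radius and constant are both taken to be n + 1, which is positive for every
    n.\<close>
  have "\<exists>\<alpha> \<beta>. real (Suc n) * (w (real (Suc n)) \<alpha> * w (real (Suc n)) \<beta>) < k \<alpha> \<beta>" for n
  proof (rule ccontr)
    assume "\<not> ?thesis"
    then have "\<forall>\<alpha> \<beta>. k \<alpha> \<beta> \<le> real (Suc n) * (w (real (Suc n)) \<alpha> * w (real (Suc n)) \<beta>)"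
      by (simp add: not_less)
    moreover have "0 < real (Suc n)" "0 \<le> real (Suc n)" by simp_all
    ultimately show False using contra by blast
  qed
  then obtain a b where ab: "\<And>n. real (Suc n) * (w (real (Suc n)) (a n) * w (real (Suc n)) (b n)) < k (a n) (b n)"
    by metis
  \<comment> \<open>The points \<open>a n\<close> may repeat, so u uses the least index at which a
    point occurs. That index is at most n and gives the smallest weight, so u at \<open>a n\<close>
    is at least the reciprocal of the weight of radius n + 1.\<close>
  define L where "L = (\<lambda>\<alpha>. LEAST n. a n = \<alpha>)"
  define u where "u = (\<lambda>\<alpha>. if \<alpha> \<in> range a then 1 / w (real (Suc (L \<alpha>))) \<alpha> else 0)"
  have L: "a (L (a n)) = a n" "L (a n) \<le> n" for n
    unfolding L_def by (auto intro: LeastI Least_le)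
  have "\<exists>r>0. \<exists>C\<ge>0. \<forall>\<alpha> \<beta>. k \<alpha> \<beta> * u \<alpha> \<le> C * w r \<beta>"
  proof (rule test)
    show "0 \<le> u \<alpha>" for \<alpha>
      using w[of "real (Suc (L \<alpha>))" \<alpha>] by (simp add: u_def)
    fix R :: real assume R: "0 < R"
    obtain N :: nat where N: "R \<le> real N" using real_arch_simple by blast
    \<comment> \<open>Beyond the index N the radius exceeds R and the quotient is at most 1; the
      finitely many remaining quotients are covered by their sum.\<close>
    define M where "M = 1 + (\<Sum>n\<le>N. w R (a n) / w (real (Suc n)) (a n))"
    have nn: "0 \<le> w R (a n) / w (real (Suc n)) (a n)" for n
      using w[OF R, of "a n"] w[of "real (Suc n)" "a n"] by simp
    have "u \<alpha> * w R \<alpha> \<le> M" for \<alpha>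
    proof (cases "\<alpha> \<in> range a")
      case False
      then show ?thesis by (simp add: u_def M_def add_nonneg_nonneg sum_nonneg nn del: of_nat_Suc)
    next
      case True
      then have \<alpha>: "a (L \<alpha>) = \<alpha>" using L(1) by auto
      have u: "u \<alpha> * w R \<alpha> = w R (a (L \<alpha>)) / w (real (Suc (L \<alpha>))) (a (L \<alpha>))"
        using True by (simp add: u_def \<alpha>)
      show ?thesis
      proof (cases "L \<alpha> \<le> N")
        case True
        then have "u \<alpha> * w R \<alpha> \<le> (\<Sum>n\<le>N. w R (a n) / w (real (Suc n)) (a n))"
          unfolding u by (intro member_le_sum) (auto simp del: of_nat_Suc intro: nn)
        then show ?thesis by (simp add: M_def)
      next
        case False
        then have "R \<le> real (Suc (L \<alpha>))" using N by simp
        then have "w R \<alpha> \<le> w (real (Suc (L \<alpha>))) \<alpha>" by (rule mono[OF R])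
        then have "u \<alpha> * w R \<alpha> \<le> 1"
          unfolding u using w[of "real (Suc (L \<alpha>))" \<alpha>] by (simp add: \<alpha> del: of_nat_Suc)
        also have "\<dots> \<le> M" unfolding M_def by (simp add: sum_nonneg nn del: of_nat_Suc)
        finally show ?thesis .
      qed
    qed
    then show "\<exists>M. \<forall>\<alpha>. u \<alpha> * w R \<alpha> \<le> M" by blast
  qed
  then obtain r C where r: "0 < r" "\<And>\<alpha> \<beta>. k \<alpha> \<beta> * u \<alpha> \<le> C * w r \<beta>" by blast
  \<comment> \<open>At this n the violation has radius at least r and constant at least C, so it
    contradicts the tested bound at the pair \<open>a n\<close>, \<open>b n\<close>.\<close>
  obtain n :: nat where n: "max r C \<le> real n" using real_arch_simple by blast
  let ?m = "real (Suc n)"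
  have m: "0 < ?m" "r \<le> ?m" "C \<le> ?m" using n by simp_all
  have wa: "0 < w ?m (a n)" by (rule w[OF m(1)])
  have "C * w r (b n) \<le> ?m * w ?m (b n)"
    using m w[OF r(1), of "b n"] mono[OF r(1) m(2), of "b n"] by (intro mult_mono) auto
  also have "\<dots> < k (a n) (b n) * (1 / w ?m (a n))"
    using ab[of n] wa by (simp add: field_simps del: of_nat_Suc)
  also have "\<dots> \<le> k (a n) (b n) * u (a n)"
  proof (rule mult_left_mono[OF _ k])
    have "w (real (Suc (L (a n)))) (a n) \<le> w ?m (a n)"
      using L(2)[of n] by (intro mono) auto
    then show "1 / w ?m (a n) \<le> u (a n)"
      using w[of "real (Suc (L (a n)))" "a n"] by (simp add: u_def frac_le del: of_nat_Suc)
  qed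
  finally show False using r(2)[of "a n" "b n"] by simp
qed


subsection \<open>Symbols\<close>

text \<open>Existence: the inverse multiplication turns the kernel k into a symbol. Uniqueness:
  applying the operator to unit sequences recovers every column of its kernel, and
  \<open>mult_exp\<close> is injective.\<close>

lemma ex1_symbol:
  fixes T :: "'d::finite fseries \<Rightarrow> 'd fseries"
  assumes D: "\<And>F. F \<in> D \<longleftrightarrow> coeff_e F \<in> E" and unit: "\<And>\<beta>. unit_seq \<beta> \<in> E"
    and S: "S = coeff_e \<circ> T \<circ> series_e"
    and k: "k = (\<lambda>\<alpha> \<beta>. S (unit_seq \<beta>) \<alpha>)"
    and sum: "\<And>c \<alpha>. c \<in> E \<Longrightarrow> ((\<lambda>\<beta>. k \<alpha> \<beta> * c \<beta>) has_sum S c \<alpha>) UNIV"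
    and mem: "diag_conv_exp (- 1) (series_e2 k) \<in> P"
  shows "\<exists>!a. a \<in> P \<and> (\<forall>F\<in>D. T F = Op_V a F)"
proof (rule ex1I)
  have "T F = Op_V (diag_conv_exp (- 1) (series_e2 k)) F" if "F \<in> D" for F
  proof -
    have "(\<Sum>\<^sub>\<infinity>\<beta>. k \<alpha> \<beta> * coeff_e F \<beta>) = coeff_e (T F) \<alpha>" for \<alpha>
      using infsumI[OF sum[of "coeff_e F" \<alpha>]] that D by (simp add: S)
    then show ?thesis by (simp add: Op_V_def kernel_op_def)
  qed
  with mem show "diag_conv_exp (- 1) (series_e2 k) \<in> P \<and>
      (\<forall>F\<in>D. T F = Op_V (diag_conv_exp (- 1) (series_e2 k)) F)" by blast
next
  fix b assume b: "b \<in> P \<and> (\<forall>F\<in>D. T F = Op_V b F)"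
  have "coeff_e2 (mult_exp b) \<alpha> \<beta> = k \<alpha> \<beta>" for \<alpha> \<beta>
  proof -
    have "series_e (unit_seq \<beta>) \<in> D" using unit D by simp
    with b have "k \<alpha> \<beta> = coeff_e (Op_V b (series_e (unit_seq \<beta>))) \<alpha>"
      by (simp add: k S)
    also have "\<dots> = (\<Sum>\<^sub>\<infinity>\<beta>'. coeff_e2 (mult_exp b) \<alpha> \<beta>' * unit_seq \<beta> \<beta>')"
      by (simp add: Op_V_def kernel_op_def)
    also have "\<dots> = (\<Sum>\<^sub>\<infinity>\<beta>'\<in>{\<beta>}. coeff_e2 (mult_exp b) \<alpha> \<beta>' * unit_seq \<beta> \<beta>')"
      by (rule infsum_cong_neutral) (auto simp: unit_seq_def)
    also have "\<dots> = coeff_e2 (mult_exp b) \<alpha> \<beta>"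
      by (simp add: unit_seq_def)
    finally show ?thesis by simp
  qed
  then have "series_e2 (coeff_e2 (mult_exp b)) = series_e2 k"
    by presburger
  then have "mult_exp b = series_e2 k" by simp
  then show "b = diag_conv_exp (- 1) (series_e2 k)"
    by (metis diag_conv_exp_mult_exp)
qed

text \<open>The factor 8 is 4 * 2: 4 for the growth of the inverse multiplication and 2 for
  summability in l^p. The radius 2 * r comes from joining the weights of \<alpha> and \<beta> into
  one weight on pairs.\<close>

lemma in_lp_symbol:
  fixes k :: "'d::finite mindex \<Rightarrow> 'd mindex \<Rightarrow> complex"
  assumes p: "1 \<le> p" and s: "s \<in> Rflat" and r: "0 < r" and R: "0 < R" and C: "0 \<le> C"
    and k: "\<And>\<alpha> \<beta>. norm (k \<alpha> \<beta>) \<le> C * (weight r s \<alpha> * weight r s \<beta>)"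
    and absorb: "\<And>\<kappa>' \<kappa> :: ('d + 'd) mindex. \<kappa>' \<le> \<kappa> \<Longrightarrow>
      8 ^ mabs \<kappa> * weight (2 * r) s \<kappa>' \<le> C' * weight R s \<kappa>"
  shows "in_lp p (\<lambda>\<kappa>. coeff_e2 (diag_conv_exp (- 1) (series_e2 k)) (\<kappa> \<circ> Inl) (\<kappa> \<circ> Inr) *
    of_real (1 / weight R s \<kappa>))"
proof (rule in_lp_if_norm_le[OF p])
  show "0 < weight R s \<kappa>" for \<kappa> :: "('d + 'd) mindex" by (rule weight_pos[OF R])
  fix \<kappa> :: "('d + 'd) mindex"
  let ?M = "C * (C' * weight R s \<kappa>) / 8 ^ mabs \<kappa>"
  have "norm (coeff_e2 (diag_conv_exp (- 1) (series_e2 k)) (\<kappa> \<circ> Inl) (\<kappa> \<circ> Inr))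
      \<le> 4 ^ (mabs (\<kappa> \<circ> Inl) + mabs (\<kappa> \<circ> Inr)) * ?M"
  proof (rule norm_diag_conv_exp_le)
    fix \<gamma> :: "'d mindex"
    \<comment> \<open>Moving down the diagonal by \<gamma> subtracts the pair (\<gamma>, \<gamma>)
      from \<kappa>, which gives the lower index to which \<open>absorb\<close> applies.\<close>
    define \<kappa>' where "\<kappa>' = \<kappa> - case_sum \<gamma> \<gamma>"
    have eq: "(\<kappa> \<circ> Inl) - \<gamma> = \<kappa>' \<circ> Inl" "(\<kappa> \<circ> Inr) - \<gamma> = \<kappa>' \<circ> Inr"
      by (auto simp: \<kappa>'_def fun_eq_iff)
    have "\<kappa>' \<le> \<kappa>" by (simp add: \<kappa>'_def le_fun_def)
    have "norm (k (\<kappa>' \<circ> Inl) (\<kappa>' \<circ> Inr)) \<le> C * weight (2 * r) s \<kappa>'"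
      using k[of "\<kappa>' \<circ> Inl" "\<kappa>' \<circ> Inr"] mult_left_mono[OF weight_mult_le[OF s r, of \<kappa>'] C]
      by linarith
    also have "\<dots> \<le> C * (C' * weight R s \<kappa> / 8 ^ mabs \<kappa>)"
      using absorb[OF \<open>\<kappa>' \<le> \<kappa>\<close>] by (intro mult_left_mono C) (simp add: field_simps)
    finally show "norm (coeff_e2 (series_e2 k) ((\<kappa> \<circ> Inl) - \<gamma>) ((\<kappa> \<circ> Inr) - \<gamma>)) \<le> ?M"
      by (simp add: eq)
  qed
  also have "mabs (\<kappa> \<circ> Inl) + mabs (\<kappa> \<circ> Inr) = mabs \<kappa>"
    by (rule mabs_Inl_Inr[symmetric])
  finally have le: "norm (coeff_e2 (diag_conv_exp (- 1) (series_e2 k)) (\<kappa> \<circ> Inl) (\<kappa> \<circ> Inr)) \<le> 4 ^ mabs \<kappa> * ?M" .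
  have "2 ^ mabs \<kappa> * norm (coeff_e2 (diag_conv_exp (- 1) (series_e2 k)) (\<kappa> \<circ> Inl) (\<kappa> \<circ> Inr))
      \<le> 2 ^ mabs \<kappa> * (4 ^ mabs \<kappa> * ?M)"
    by (rule mult_left_mono[OF le]) simp
  also have "\<dots> = (2 * 4) ^ mabs \<kappa> * ?M"
    unfolding power_mult_distrib by (simp only: mult.assoc)
  also have "\<dots> = C * C' * weight R s \<kappa>" by simp
  finally show "2 ^ mabs \<kappa> * norm (coeff_e2 (diag_conv_exp (- 1) (series_e2 k)) (\<kappa> \<circ> Inl) (\<kappa> \<circ> Inr))
      \<le> C * C' * weight R s \<kappa>" .
qed

section \<open>Passage from power series to coefficient sequences\<close>

lemma clinear_on_coeff_e:
  fixes T :: "'d::finite fseries \<Rightarrow> 'd fseries"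
  assumes "clinear_on D T" and D: "\<And>F. F \<in> D \<longleftrightarrow> coeff_e F \<in> E"
  shows "clinear_on E (coeff_e \<circ> T \<circ> series_e)"
proof -
  have 1: "series_e (c + d) = series_e c + series_e d" for c d :: "'d mseq"
    by (simp add: series_e_def fun_eq_iff add_divide_distrib)
  have 2: "series_e (\<lambda>\<alpha>. x * c \<alpha>) = (\<lambda>\<alpha>. x * series_e c \<alpha>)" for x and c :: "'d mseq"
    by (simp add: series_e_def fun_eq_iff)
  have 3: "coeff_e (F + G) = coeff_e F + coeff_e G" for F G :: "'d fseries"
    by (simp add: coeff_e_def fun_eq_iff distrib_left)
  have 4: "coeff_e (\<lambda>\<alpha>. x * F \<alpha>) = (\<lambda>\<alpha>. x * coeff_e F \<alpha>)" for x and F :: "'d fseries"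
    by (simp add: coeff_e_def fun_eq_iff)
  have D': "series_e c \<in> D" if "c \<in> E" for c
    using that D by simp
  show ?thesis
    using assms(1) D' unfolding clinear_on_def by (simp add: 1 2 3 4)
qed

lemma continuous_map_coeff_e:
  fixes T :: "'d::finite fseries \<Rightarrow> 'd fseries"
  assumes "continuous_map (pullback_topology UNIV coeff_e X) (pullback_topology UNIV coeff_e Y) T"
  shows "continuous_map X Y (coeff_e \<circ> T \<circ> series_e)"
proof -
  have "continuous_map X (pullback_topology UNIV coeff_e X) series_e"
    by (rule continuous_map_pullback') (auto simp: o_def)
  moreover have "continuous_map (pullback_topology UNIV coeff_e Y) Y ((\<lambda>c. c) \<circ> coeff_e)"
    by (rule continuous_map_pullback) simp
  then have "continuous_map (pullback_topology UNIV coeff_e Y) Y coeff_e" by (simp add: o_def)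
  ultimately show ?thesis
    using assms by (auto intro: continuous_map_compose simp: o_assoc)
qed

section \<open>The three cases: s = 0, the spaces of index s < 1/2, the spaces of index 0,s with s
  \<le> 1/2\<close>

text \<open>Linear algebra: the coefficient sequences in the domain have finite support, so the
  kernel sums are finite, and the symbol space contains all formal series.\<close>

lemma ex1_symbol_Num_0:
  fixes T :: "'d::finite fseries \<Rightarrow> 'd fseries"
  assumes lin: "clinear_on (topspace (A_s p (Num 0))) T"
  shows "\<exists>!a. a \<in> A_tilde_s' p (Num 0) \<and> (\<forall>F\<in>topspace (A_s p (Num 0)). T F = Op_V a F)"
proof -
  define E where "E = (\<Union>N. {c :: 'd mseq. \<forall>\<alpha>. N < mabs \<alpha> \<longrightarrow> c \<alpha> = 0})"
  have D: "F \<in> topspace (A_s p (Num 0)) \<longleftrightarrow> coeff_e F \<in> E" for F :: "'d fseries"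
    by (simp add: A_s_def ell_s_def topspace_pullback_topology topspace_inductive_limit E_def)
  let ?S = "coeff_e \<circ> T \<circ> series_e"
  have lin_S: "clinear_on E ?S" by (rule clinear_on_coeff_e[OF lin D])
  have unit: "unit_seq \<beta> \<in> E" for \<beta>
    by (auto simp: E_def unit_seq_def intro!: exI[of _ "mabs \<beta>"])
  have add: "c + d \<in> E" if cd: "c \<in> E" "d \<in> E" for c d
  proof -
    from cd obtain N M where "\<forall>\<alpha>. N < mabs \<alpha> \<longrightarrow> c \<alpha> = 0" "\<forall>\<alpha>. M < mabs \<alpha> \<longrightarrow> d \<alpha> = 0"
      by (auto simp: E_def)
    then have "\<forall>\<alpha>. max N M < mabs \<alpha> \<longrightarrow> (c + d) \<alpha> = 0" by simp
    then show ?thesis unfolding E_def by blast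
  qed
  have scale: "(\<lambda>\<alpha>. x * c \<alpha>) \<in> E" if "c \<in> E" for c x
    using that unfolding E_def by fastforce
  show ?thesis
  proof (rule ex1_symbol[OF D unit refl refl])
    fix c \<alpha> assume "c \<in> E"
    then obtain N where N: "\<And>\<alpha>. N < mabs \<alpha> \<Longrightarrow> c \<alpha> = 0" by (auto simp: E_def)
    \<comment> \<open>Each coordinate of \<beta> is at most |\<beta>|, so this finite box contains
      the support of c.\<close>
    define A where "A = {\<beta> :: 'd mindex. \<beta> \<le> (\<lambda>_. N)}"
    have A: "finite A" unfolding A_def by (rule finite_mindex_interval)
    have out: "c \<beta> = 0" if "\<beta> \<notin> A" for \<beta>
    proof (rule N)
      from that obtain i where "N < \<beta> i" by (auto simp: A_def le_fun_def not_le)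
      also have "\<beta> i \<le> mabs \<beta>" unfolding mabs_def by (rule member_le_sum) auto
      finally show "N < mabs \<beta>" .
    qed
    have "(\<lambda>\<beta>. if \<beta> \<in> A then c \<beta> else 0) = c"
      by (rule ext) (simp add: out)
    then have "?S c = (\<lambda>\<alpha>. \<Sum>\<beta>\<in>A. ?S (unit_seq \<beta>) \<alpha> * c \<beta>)"
      using clinear_on_restrict[OF lin_S unit add scale A, of c] by (simp only:)
    then have eq: "?S c \<alpha> = (\<Sum>\<beta>\<in>A. ?S (unit_seq \<beta>) \<alpha> * c \<beta>)"
      by (rule fun_cong)
    show "((\<lambda>\<beta>. ?S (unit_seq \<beta>) \<alpha> * c \<beta>) has_sum ?S c \<alpha>) UNIV"
      by (rule has_sum_finite_neutralI[OF A subset_UNIV _ eq]) (use out in simp)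
  next
    show "diag_conv_exp (- 1) (series_e2 (\<lambda>\<alpha> \<beta>. ?S (unit_seq \<beta>) \<alpha>)) \<in> A_tilde_s' p (Num 0)"
      by (simp add: A_tilde_s'_def ell_s'_def)
  qed
qed

lemma ex1_symbol_A_s:
  fixes T :: "'d::finite fseries \<Rightarrow> 'd fseries"
  assumes p: "1 \<le> p" and s: "s \<in> Rflat" "s < Num (1/2)"
    and lin: "clinear_on (topspace (A_s p s)) T" and cont: "continuous_map (A_s p s) (A_s' p s) T"
  shows "\<exists>!a. a \<in> A_tilde_s' p s \<and> (\<forall>F\<in>topspace (A_s p s). T F = Op_V a F)"
proof -
  have s0: "s \<noteq> Num 0" using s by (auto simp: Rflat_def)
  let ?w = "\<lambda>r. weight r s"
  define E where "E = (\<Union>X\<in>(\<lambda>r. weighted_lp p (?w r :: 'd mindex \<Rightarrow> real)) ` {0<..}. topspace X)"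
  have D: "F \<in> topspace (A_s p s) \<longleftrightarrow> coeff_e F \<in> E" for F :: "'d fseries"
    using s0 by (simp add: A_s_def ell_s_def topspace_pullback_topology topspace_inductive_limit E_def)
  define S where "S = coeff_e \<circ> T \<circ> series_e"
  have lin_S: "clinear_on E S" unfolding S_def by (rule clinear_on_coeff_e[OF lin D])
  have cont_S: "continuous_map (inductive_limit ((\<lambda>r. weighted_lp p (?w r)) ` {0<..}))
      (projective_limit ((\<lambda>r. weighted_lp p (\<lambda>\<alpha>. 1 / ?w r \<alpha>)) ` {0<..})) S"
    unfolding S_def using cont s0 by (intro continuous_map_coeff_e) (simp add: A_s_def A_s'_def ell_s_def ell_s'_def)
  have bound: "\<exists>C\<ge>0. \<forall>c. wsummable (?w r) c \<longrightarrow> (\<forall>\<alpha>. norm (S c \<alpha>) \<le> C * ?w R \<alpha> * wsum (?w r) c)"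
    if "0 < r" "0 < R" for r R
    using that lin_S unfolding E_def
    by (intro continuous_inductive_to_projective_bound[OF p _ _ cont_S]) (auto intro: weight_pos less_imp_le)
  have sub: "c \<in> E" if "wsummable (?w r) c" "0 < r" for r c
    using that wsummable_imp_in_lp(1)[OF p _ that(1)] unfolding E_def
    by (force simp: topspace_weighted_lp weight_pos less_imp_le)
  have unit: "unit_seq \<beta> \<in> E" for \<beta>
    by (rule sub[OF wsummable_unit_seq zero_less_one])
  show ?thesis
  proof (rule ex1_symbol[OF D unit S_def refl])
    fix c \<alpha> assume "c \<in> E"
    then obtain R where R: "0 < R" "in_lp p (\<lambda>\<alpha>. c \<alpha> * of_real (?w R \<alpha>))"
      by (auto simp: E_def topspace_weighted_lp)
    \<comment> \<open>In the union of the steps it is harmless to shrink the radius; doing so trades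
      the l^p norm for a weighted l^1 norm.\<close>
    obtain r C where r: "0 < r" "C \<ge> 0" "\<And>\<kappa>' \<kappa> :: 'd mindex. \<kappa>' \<le> \<kappa> \<Longrightarrow> 2 ^ mabs \<kappa> * ?w r \<kappa>' \<le> C * ?w R \<kappa>"
      using weight_absorb_below[OF s R(1), of 2] by auto
    have c: "wsummable (?w r) c"
      using R r by (intro wsummable_if_in_lp[OF p R(2), of _ C]) (auto intro: weight_pos less_imp_le)
    \<comment> \<open>With \<alpha> fixed, any target radius bounds the coefficient of S c; 1 is
      taken.\<close>
    obtain C' where "\<forall>c. wsummable (?w r) c \<longrightarrow> (\<forall>\<alpha>. norm (S c \<alpha>) \<le> C' * ?w 1 \<alpha> * wsum (?w r) c)"
      using bound[OF r(1) zero_less_one] by blast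
    moreover have "clinear_on {c. wsummable (?w r) c} S"
      using lin_S sub[OF _ r(1)] by (auto simp: clinear_on_def)
    ultimately show "((\<lambda>\<beta>. S (unit_seq \<beta>) \<alpha> * c \<beta>) has_sum S c \<alpha>) UNIV"
      using c r(1)
      by (intro clinear_on_has_sum[where E = "{c. wsummable (?w r) c}" and w = "?w r" and C = "C' * ?w 1 \<alpha>"])
        (auto simp: wsummable_unit_seq intro: wsummable_add wsummable_scale weight_pos less_imp_le)
  next
    let ?k = "\<lambda>\<alpha> \<beta>. S (unit_seq \<beta>) \<alpha>"
    have "in_lp p (\<lambda>\<kappa>. coeff_e2 (diag_conv_exp (- 1) (series_e2 ?k)) (\<kappa> \<circ> Inl) (\<kappa> \<circ> Inr) *
      of_real (1 / ?w R \<kappa>))" if R: "0 < R" for R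
    proof -
      obtain r' C' where r': "0 < r'"
        "\<And>\<kappa>' \<kappa> :: ('d + 'd) mindex. \<kappa>' \<le> \<kappa> \<Longrightarrow> 8 ^ mabs \<kappa> * ?w r' \<kappa>' \<le> C' * ?w R \<kappa>"
        using weight_absorb_below[OF s R, of 8] by auto
      \<comment> \<open>The kernel bound holds for all pairs of radii, so they are chosen after R:
        both are r'/2, which \<open>weight_mult_le\<close> doubles to r'.\<close>
      obtain C where C: "0 \<le> C" "\<And>c \<alpha>. wsummable (?w (r' / 2)) c \<Longrightarrow> norm (S c \<alpha>) \<le> C * ?w (r' / 2) \<alpha> * wsum (?w (r' / 2)) c"
        using bound[of "r' / 2" "r' / 2"] r'(1) by auto
      show ?thesis
      proof (rule in_lp_symbol[OF p s(1) _ R C(1)])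
        show "norm (?k \<alpha> \<beta>) \<le> C * (?w (r' / 2) \<alpha> * ?w (r' / 2) \<beta>)" for \<alpha> \<beta>
          using C(2)[OF wsummable_unit_seq, of \<beta> \<alpha>] by (simp add: wsum_unit_seq mult.assoc)
      qed (use r' in auto)
    qed
    then show "diag_conv_exp (- 1) (series_e2 ?k) \<in> A_tilde_s' p s"
      using s0 by (auto simp: A_tilde_s'_def ell_s'_def topspace_projective_limit topspace_weighted_lp)
  qed
qed

lemma ex1_symbol_A_0s:
  fixes T :: "'d::finite fseries \<Rightarrow> 'd fseries"
  assumes p: "1 \<le> p" and s: "s \<in> Rflat" "s \<le> Num (1/2)"
    and lin: "clinear_on (topspace (A_0s p s)) T" and cont: "continuous_map (A_0s p s) (A_0s' p s) T"
  shows "\<exists>!a. a \<in> A_tilde_0s' p s \<and> (\<forall>F\<in>topspace (A_0s p s). T F = Op_V a F)"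
proof -
  let ?w = "\<lambda>r. weight r s"
  define E where "E = (\<Inter>X\<in>(\<lambda>r. weighted_lp p (?w r :: 'd mindex \<Rightarrow> real)) ` {0<..}. topspace X)"
  have D: "F \<in> topspace (A_0s p s) \<longleftrightarrow> coeff_e F \<in> E" for F :: "'d fseries"
    by (simp add: A_0s_def ell_0s_def topspace_pullback_topology topspace_projective_limit E_def)
  have E_iff: "c \<in> E \<longleftrightarrow> (\<forall>r>0. in_lp p (\<lambda>\<alpha>. c \<alpha> * of_real (?w r \<alpha>)))" for c
    by (auto simp: E_def topspace_weighted_lp)
  define S where "S = coeff_e \<circ> T \<circ> series_e"
  have lin_S: "clinear_on E S" unfolding S_def by (rule clinear_on_coeff_e[OF lin D])
  have cont_S: "continuous_map (projective_limit ((\<lambda>r. weighted_lp p (?w r)) ` {0<..}))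
      (inductive_limit ((\<lambda>r. weighted_lp p (\<lambda>\<alpha>. 1 / ?w r \<alpha>)) ` {0<..})) S"
    unfolding S_def using cont by (intro continuous_map_coeff_e) (simp add: A_0s_def A_0s'_def ell_0s_def ell_0s'_def)
  have summable: "wsummable (?w r) c" if c: "c \<in> E" and r: "0 < r" for c r
  proof -
    obtain R C where R: "0 < R" "C \<ge> 0" "\<And>\<kappa>' \<kappa> :: 'd mindex. \<kappa>' \<le> \<kappa> \<Longrightarrow> 2 ^ mabs \<kappa> * ?w r \<kappa>' \<le> C * ?w R \<kappa>"
      using weight_absorb_above[OF s r, of 2] by auto
    have "in_lp p (\<lambda>\<alpha>. c \<alpha> * of_real (?w R \<alpha>))" using c R(1) E_iff by blast
    then show ?thesis
      using R r by (intro wsummable_if_in_lp[OF p, of c "?w R" _ C]) (auto intro: weight_pos less_imp_le)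
  qed
  have E_iff': "c \<in> E \<longleftrightarrow> (\<forall>r>0. wsummable (?w r) c)" for c
  proof
    assume "\<forall>r>0. wsummable (?w r) c"
    then have "in_lp p (\<lambda>\<alpha>. c \<alpha> * of_real (?w r \<alpha>))" if "0 < r" for r
      using that by (intro wsummable_imp_in_lp(1)[OF p]) (auto intro: weight_pos less_imp_le)
    then show "c \<in> E" unfolding E_iff by blast
  qed (use summable in blast)
  have bound: "\<exists>r>0. \<exists>C\<ge>0. \<forall>c\<in>E. \<forall>\<alpha>. norm (S c \<alpha>) * u \<alpha> \<le> C * wsum (?w r) c"
    if "\<And>\<alpha>. 0 \<le> u \<alpha>" "\<And>R. 0 < R \<Longrightarrow> \<exists>M. \<forall>\<alpha>. u \<alpha> * ?w R \<alpha> \<le> M" for u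
    unfolding E_def
  proof (rule continuous_projective_to_inductive_bound[OF p _ _ _ _ cont_S _ that])
    show "clinear_on (\<Inter>X\<in>(\<lambda>r. weighted_lp p (?w r)) ` {0<..}. topspace X) S"
      using lin_S unfolding E_def .
    show "wsummable (?w r) c"
      if "c \<in> (\<Inter>X\<in>(\<lambda>r. weighted_lp p (?w r :: 'd mindex \<Rightarrow> real)) ` {0<..}. topspace X)" "0 < r" for c r
      using summable that unfolding E_def .
  qed (simp_all add: weight_pos weight_mono less_imp_le)
  have unit: "unit_seq \<beta> \<in> E" for \<beta>
    by (simp add: E_iff' wsummable_unit_seq)
  have add: "c + d \<in> E" if "c \<in> E" "d \<in> E" for c d
    unfolding E_iff'
  proof (intro allI impI)
    fix r :: real assume r: "0 < r"
    have "0 \<le> ?w r \<alpha>" for \<alpha> :: "'d mindex" by (rule less_imp_le[OF weight_pos[OF r]])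
    then show "wsummable (?w r) (c + d)"
      by (rule wsummable_add[OF _ summable[OF that(1) r] summable[OF that(2) r]])
  qed
  have scale: "(\<lambda>\<alpha>. x * c \<alpha>) \<in> E" if "c \<in> E" for c x
    using that unfolding E_iff' by (blast intro: wsummable_scale)
  show ?thesis
  proof (rule ex1_symbol[OF D unit S_def refl])
    fix c \<alpha> assume c: "c \<in> E"
    \<comment> \<open>The indicator of the single index \<alpha> is an admissible test sequence and
      yields continuity of the coefficient functional at \<alpha>.\<close>
    have "\<exists>r>0. \<exists>C\<ge>0. \<forall>c\<in>E. \<forall>\<beta>. norm (S c \<beta>) * (if \<beta> = \<alpha> then 1 else 0) \<le> C * wsum (?w r) c"
    proof (rule bound)
      fix R :: real assume "0 < R"
      then show "\<exists>M. \<forall>\<beta>. (if \<beta> = \<alpha> then 1 else 0) * ?w R \<beta> \<le> M"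
        by (intro exI[of _ "?w R \<alpha>"]) (simp add: weight_pos less_imp_le)
    qed simp
    then obtain r C where r: "0 < r" "\<And>c \<beta>. c \<in> E \<Longrightarrow> norm (S c \<beta>) * (if \<beta> = \<alpha> then 1 else 0) \<le> C * wsum (?w r) c"
      by blast
    have bd: "norm (S c \<alpha>) \<le> C * wsum (?w r) c" if "c \<in> E" for c
      using r(2)[OF that, of \<alpha>] by simp
    show "((\<lambda>\<beta>. S (unit_seq \<beta>) \<alpha> * c \<beta>) has_sum S c \<alpha>) UNIV"
      by (rule clinear_on_has_sum[OF lin_S unit add scale bd c summable[OF c r(1)]])
  next
    let ?k = "\<lambda>\<alpha> \<beta>. S (unit_seq \<beta>) \<alpha>"
    have "\<exists>r>0. \<exists>C\<ge>0. \<forall>\<alpha> \<beta>. norm (?k \<alpha> \<beta>) \<le> C * (?w r \<alpha> * ?w r \<beta>)"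
    proof (rule kernel_bound_if_tested)
      fix u :: "'d mindex \<Rightarrow> real"
      assume u: "\<And>\<alpha>. 0 \<le> u \<alpha>" "\<And>R. 0 < R \<Longrightarrow> \<exists>M. \<forall>\<alpha>. u \<alpha> * ?w R \<alpha> \<le> M"
      obtain r C where r: "0 < r" "0 \<le> C" "\<And>c \<alpha>. c \<in> E \<Longrightarrow> norm (S c \<alpha>) * u \<alpha> \<le> C * wsum (?w r) c"
        using bound[OF u] by blast
      show "\<exists>r>0. \<exists>C\<ge>0. \<forall>\<alpha> \<beta>. norm (?k \<alpha> \<beta>) * u \<alpha> \<le> C * ?w r \<beta>"
        using r(1,2) r(3)[OF unit] by (auto simp: wsum_unit_seq)
    qed (auto intro: weight_pos weight_mono)
    then obtain r C where r: "0 < r" "0 \<le> C" "\<And>\<alpha> \<beta>. norm (?k \<alpha> \<beta>) \<le> C * (?w r \<alpha> * ?w r \<beta>)"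
      by blast
    \<comment> \<open>The order of choices is reversed here: the gliding hump provides one radius r,
      and a large enough R is found for it. One such R suffices, since the symbol space is a union
      over R.\<close>
    obtain R C' where R: "0 < R"
      "\<And>\<kappa>' \<kappa> :: ('d + 'd) mindex. \<kappa>' \<le> \<kappa> \<Longrightarrow> 8 ^ mabs \<kappa> * ?w (2 * r) \<kappa>' \<le> C' * ?w R \<kappa>"
      using weight_absorb_above[OF s, of "2 * r" 8] r(1) by auto
    have "in_lp p (\<lambda>\<kappa>. coeff_e2 (diag_conv_exp (- 1) (series_e2 ?k)) (\<kappa> \<circ> Inl) (\<kappa> \<circ> Inr) *
      of_real (1 / ?w R \<kappa>))"
      by (rule in_lp_symbol[OF p s(1) r(1) R(1) r(2) r(3) R(2)])
    then show "diag_conv_exp (- 1) (series_e2 ?k) \<in> A_tilde_0s' p s"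
      using R(1) by (auto simp: A_tilde_0s'_def ell_0s'_def topspace_inductive_limit topspace_weighted_lp)
  qed
qed

theorem theorem3p7:
  fixes p :: ereal
  assumes "1 \<le> p"
  shows
    "(\<forall>s (T :: 'd::finite fseries \<Rightarrow> 'd fseries).
        s \<in> Rflat0 \<longrightarrow> s < Num (1/2) \<longrightarrow>
        clinear_on (topspace (A_s p s)) T \<longrightarrow> continuous_map (A_s p s) (A_s' p s) T \<longrightarrow>
        (\<exists>!a. a \<in> A_tilde_s' p s \<and> (\<forall>F\<in>topspace (A_s p s). T F = Op_V a F)))
   \<and> (\<forall>s (T :: 'd::finite fseries \<Rightarrow> 'd fseries).
        s \<in> Rflat \<longrightarrow> s \<le> Num (1/2) \<longrightarrow>
        clinear_on (topspace (A_0s p s)) T \<longrightarrow> continuous_map (A_0s p s) (A_0s' p s) T \<longrightarrow>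
        (\<exists>!a. a \<in> A_tilde_0s' p s \<and> (\<forall>F\<in>topspace (A_0s p s). T F = Op_V a F)))"
proof (intro conjI allI impI)
  fix s :: rflat and T :: "'d fseries \<Rightarrow> 'd fseries"
  assume *: "s \<in> Rflat0" "s < Num (1/2)" "clinear_on (topspace (A_s p s)) T"
    "continuous_map (A_s p s) (A_s' p s) T"
  from *(1) consider "s = Num 0" | "s \<in> Rflat" by (auto simp: Rflat0_def)
  then show "\<exists>!a. a \<in> A_tilde_s' p s \<and> (\<forall>F\<in>topspace (A_s p s). T F = Op_V a F)"
  proof cases
    case 1
    with * show ?thesis by (simp add: ex1_symbol_Num_0)
  next
    case 2
    with * assms show ?thesis by (intro ex1_symbol_A_s)
  qed
qed (rule ex1_symbol_A_0s[OF assms])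

end
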